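(* Let $a^-,a^+\in\mathbb{R}^2$ with $a_1^-=a_1^+$ and $a_2^-<a_2^+$. Suppose that $W:\mathbb{R}^2\to[0,\infty)$ is continuous and that there are constants $c_1,c_2>0$ and $\bar p>0$ such that $c_1|y|^{2\bar p}-1\le W(y)\le c_2(|y|^{2\bar p}+1)$ for all $y\in\mathbb{R}^2$. Let $\lambda:\mathbb{R}^2\to[-1,1]$ be a Borel measurable function, and suppose that $h\in C^2_{2+\bar p}(\mathbb{R}^2)$ satisfies $\frac{\partial^2h}{\partial y_1^2}=-\lambda\sqrt W$ in $\mathbb{R}^2$. Then for any $T\in\mathcal{C}^0_{2\times2}$, $$\mathbf{M}_F(T)\ge\frac12\inf_{\gamma\in\Gamma_1}Z_{\lambda,h}(\gamma).$$
   Context: For $j\in\{0,1,2,\dots\}$ and a real exponent $q>0$, $C^j_q(\mathbb{R}^2)$ is the space of all $\phi\in C^j(\mathbb{R}^2)$ for which there is $C\ge0$ with $|D^k\phi(y)|\le C(|y|^{q-k}+1)$ for all $y\in\mathbb{R}^2$ and $k=0,\dots,j$. For $M,N\in\mathbb{R}^{2\times 2}$, $M:N=\operatorname{tr}(M^{\mathsf T}N)$ and $|M|=\sqrt{M:M}$. Curve functional. For $\lambda\in[-1,1]$ define $\Theta_\lambda:\mathbb{R}^2\to\mathbb{R}$ by $$\Theta_\lambda(z)=\begin{cases}(1+\lambda)\frac{z_1^2}{|z_2|}+|z_2|&\text{if }z_2>0\text{ and }(1+\lambda)z_1^2<(1-\lambda)z_2^2,\\(1-\lambda)\frac{z_1^2}{|z_2|}+|z_2|&\text{if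 }z_2<0\text{ and }(1-\lambda)z_1^2<(1+\lambda)z_2^2,\\2|z_1|\sqrt{1-\lambda^2}+\lambda z_2&\text{otherwise}.\end{cases}$$ $\Gamma_1$ is the set of all Lipschitz maps $\gamma:[0,1]\to\mathbb{R}^2$ with $\gamma(0)=a^-$ and $\gamma(1)=a^+$. For a Borel function $\lambda:\mathbb{R}^2\to[-1,1]$, $h\in C^2(\mathbb{R}^2)$ and a Lipschitz curve $\gamma:[0,1]\to\mathbb{R}^2$, $$Z_{\lambda,h}(\gamma)=\int_0^1\left(\sqrt{W(\gamma(t))}\,\Theta_{\lambda(\gamma(t))}(\dot\gamma(t))+\frac{\partial^2h}{\partial y_2^2}(\gamma(t))\,\dot\gamma_2(t)\right)dt-\frac{\partial h}{\partial y_2}(\gamma(1))+\frac{\partial h}{\partial y_2}(\gamma(0)).$$ Currents. An $\mathbb{R}^2$-valued $1$-current on $\mathbb{R}^2$ is an element $T$ of the dual space of $C_0^\infty(\mathbb{R}^2;\mathbb{R}^{2\times2})$ (smooth, compactly supported). Its boundary is the $\mathbb{R}^2$-valued distribution $\partial T(\xi)=T(D\xi)$, $\xi\in C_0^\infty(\mathbb{R}^2;\mathbb{R}^2)$. $T$ is normal if there is $C\ge0$ with $T(\zeta)+\partial T(\xi)\le C\sup_{x\in\mathbb{R}^2}(|\zeta(x)|+|\xi(x)|)$ for all $\zeta\in C_0^\infty(\mathbb{R}^2;\mathbb{R}^{2\times 2})$, $\xi\in C_0^\infty(\mathbb{R}^2;\mathbb{R}^2)$. For normal $T$ there are a Radon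 measure $\|T\|$ and a $\|T\|$-measurable $\vec T:\mathbb{R}^2\to\mathbb{R}^{2\times2}$ with $|\vec T|=1$ almost everywhere and $T(\zeta)=\int_{\mathbb{R}^2}\zeta:\vec T\,d\|T\|$ for all $\zeta$. $\mathcal{C}^0_{2\times2}$ denotes the set of all normal $\mathbb{R}^2$-valued $1$-currents $T$ with $\partial T(\xi)=\xi_1(a^+)-\xi_1(a^-)$ for all $\xi=(\xi_1,\xi_2)\in C_0^\infty(\mathbb{R}^2;\mathbb{R}^2)$. $F$-mass. For $y\in\mathbb{R}^2$ and $N=\begin{pmatrix} n_{11} & n_{12} \\ n_{21} & n_{22} \end{pmatrix}$ let $F^*(y,N)=\frac14W(y)\max\{|N|^2-2\det N,(n_{12}-n_{21})^2\}$ if $\operatorname{tr}N=0$ and $F^*(y,N)=\infty$ otherwise. For $T\in\mathcal{C}^0_{2\times2}$ let $\mathbf{M}_F(T)=\int_{\mathbb{R}^2}\sqrt{F^*(y,\vec T(y))}\,d\|T\|(y)$. *)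

theory Defs
  imports "HOL-Analysis.Analysis"
begin

text \<open>Points of the plane have type \<^typ>\<open>real^2\<close> and matrices type \<^typ>\<open>real^2^2\<close>, where \<open>M $ i $ j\<close>
  is the entry in row \<open>i\<close> and column \<open>j\<close>. The product \<open>M : N\<close> and the norm \<open>|M|\<close> are the library's
  inner product and norm on \<^typ>\<open>real^2^2\<close>.\<close>

lemma inner_matrix_eq_trace:
  fixes M N :: "real^2^2"
  shows "M \<bullet> N = trace (transpose M ** N)"
  by (simp add: inner_vec_def trace_def transpose_def matrix_matrix_mult_def sum_2)

lemma norm_matrix_eq_sqrt_trace:
  fixes M :: "real^2^2"
  shows "norm M = sqrt (trace (transpose M ** M))"
  by (simp only: norm_eq_sqrt_inner inner_matrix_eq_trace)


definition partial :: "2 \<Rightarrow> (real^2 \<Rightarrow> 'b::real_normed_vector) \<Rightarrow> real^2 \<Rightarrow> 'b" where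
  "partial i \<phi> y = frechet_derivative \<phi> (at y) (axis i 1)"

primrec Cj :: "nat \<Rightarrow> (real^2 \<Rightarrow> 'b::real_normed_vector) \<Rightarrow> bool" where
  "Cj 0 \<phi> \<longleftrightarrow> continuous_on UNIV \<phi>"
| "Cj (Suc j) \<phi> \<longleftrightarrow> (\<forall>y. \<phi> differentiable (at y)) \<and> (\<forall>i. Cj j (partial i \<phi>))"

text \<open>\<open>norm_D k \<phi> y\<close> is the Euclidean norm of the \<open>k\<close>-th derivative tensor \<open>D\<^sup>k\<phi>(y)\<close>; a list
  \<open>[i\<^sub>1, \<dots>, i\<^sub>k]\<close> indexes the component \<open>\<partial>\<^sub>i\<^sub>1 \<dots> \<partial>\<^sub>i\<^sub>k \<phi>(y)\<close>.\<close>

definition norm_D :: "nat \<Rightarrow> (real^2 \<Rightarrow> 'b::real_normed_vector) \<Rightarrow> real^2 \<Rightarrow> real" where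
  "norm_D k \<phi> y = sqrt (\<Sum>is | length is = k. (norm (foldr partial is \<phi> y))\<^sup>2)"

text \<open>At \<open>y = 0\<close> the library has \<open>0 powr a = 0\<close> for every \<open>a\<close>. This makes no difference when
  \<open>q > k\<close>; when \<open>q \<le> k\<close> it only affects the value at a single point, which can be absorbed into
  the constant \<open>C\<close>.\<close>

definition Cjq :: "nat \<Rightarrow> real \<Rightarrow> (real^2 \<Rightarrow> real) set" where
  "Cjq j q = {\<phi>. Cj j \<phi> \<and>
     (\<exists>C\<ge>0. \<forall>y. \<forall>k\<le>j. norm_D k \<phi> y \<le> C * (norm y powr (q - real k) + 1))}"


definition Theta :: "real \<Rightarrow> real^2 \<Rightarrow> real" where
  "Theta l z =
     (if z$2 > 0 \<and> (1 + l) * (z$1)\<^sup>2 < (1 - l) * (z$2)\<^sup>2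
        then (1 + l) * ((z$1)\<^sup>2 / \<bar>z$2\<bar>) + \<bar>z$2\<bar>
      else if z$2 < 0 \<and> (1 - l) * (z$1)\<^sup>2 < (1 + l) * (z$2)\<^sup>2
        then (1 - l) * ((z$1)\<^sup>2 / \<bar>z$2\<bar>) + \<bar>z$2\<bar>
      else 2 * \<bar>z$1\<bar> * sqrt (1 - l\<^sup>2) + l * z$2)"

text \<open>Curves are functions on all of \<^typ>\<open>real\<close> of which only the restriction to \<open>[0,1]\<close> matters.\<close>

definition Gamma1 :: "real^2 \<Rightarrow> real^2 \<Rightarrow> (real \<Rightarrow> real^2) set" where
  "Gamma1 am ap = {\<gamma>. (\<exists>L. L-lipschitz_on {0..1} \<gamma>) \<and> \<gamma> 0 = am \<and> \<gamma> 1 = ap}"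

text \<open>A Lipschitz curve is differentiable almost everywhere; on the remaining null set
  \<open>vector_derivative\<close> takes unspecified values, which the integral ignores.\<close>

definition Z_fun ::
  "(real^2 \<Rightarrow> real) \<Rightarrow> (real^2 \<Rightarrow> real) \<Rightarrow> (real^2 \<Rightarrow> real) \<Rightarrow> (real \<Rightarrow> real^2) \<Rightarrow> real" where
  "Z_fun W lam h \<gamma> =
     (\<integral>t. (let \<gamma>' = vector_derivative \<gamma> (at t within {0..1}) in
             sqrt (W (\<gamma> t)) * Theta (lam (\<gamma> t)) \<gamma>' + partial 2 (partial 2 h) (\<gamma> t) * \<gamma>'$2)
        \<partial>lebesgue_on {0..1})
     - partial 2 h (\<gamma> 1) + partial 2 h (\<gamma> 0)"


definition test_fun :: "(real^2 \<Rightarrow> 'b::real_normed_vector) set" where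
  "test_fun = {\<zeta>. (\<forall>j. Cj j \<zeta>) \<and> compact (closure {x. \<zeta> x \<noteq> 0})}"

text \<open>A current is a linear functional on test functions, continuous with respect to the usual
  inductive limit topology, that is, bounded by a \<open>C\<^sup>m\<close>-norm on test functions supported in any
  given compact set. Values of \<open>T\<close> off \<^const>\<open>test_fun\<close> are irrelevant.\<close>

definition current :: "((real^2 \<Rightarrow> real^2^2) \<Rightarrow> real) \<Rightarrow> bool" where
  "current T \<longleftrightarrow>
     (\<forall>\<zeta>\<in>test_fun. \<forall>\<eta>\<in>test_fun. T (\<lambda>x. \<zeta> x + \<eta> x) = T \<zeta> + T \<eta>) \<and>
     (\<forall>c. \<forall>\<zeta>\<in>test_fun. T (\<lambda>x. c *\<^sub>R \<zeta> x) = c * T \<zeta>) \<and>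
     (\<forall>K. compact K \<longrightarrow> (\<exists>C m. \<forall>\<zeta>\<in>test_fun. closure {x. \<zeta> x \<noteq> 0} \<subseteq> K \<longrightarrow>
        \<bar>T \<zeta>\<bar> \<le> C * (\<Sum>k\<le>m. SUP x. norm_D k \<zeta> x)))"

definition bdry :: "((real^2 \<Rightarrow> real^2^2) \<Rightarrow> real) \<Rightarrow> (real^2 \<Rightarrow> real^2) \<Rightarrow> real" where
  "bdry T \<xi> = T (\<lambda>x. jacobian \<xi> (at x))"

definition normal_current :: "((real^2 \<Rightarrow> real^2^2) \<Rightarrow> real) \<Rightarrow> bool" where
  "normal_current T \<longleftrightarrow> current T \<and>
     (\<exists>C\<ge>0. \<forall>\<zeta>\<in>test_fun. \<forall>\<xi>\<in>test_fun.
        T \<zeta> + bdry T \<xi> \<le> C * (SUP x. norm (\<zeta> x) + norm (\<xi> x)))"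

definition C0_currents :: "real^2 \<Rightarrow> real^2 \<Rightarrow> ((real^2 \<Rightarrow> real^2^2) \<Rightarrow> real) set" where
  "C0_currents am ap =
     {T. normal_current T \<and> (\<forall>\<xi>\<in>test_fun. bdry T \<xi> = \<xi> ap $ 1 - \<xi> am $ 1)}"

text \<open>\<open>\<mu>\<close> and \<open>\<tau>\<close> play the roles of \<open>\<parallel>T\<parallel>\<close> and the orientation of \<open>T\<close>. By the Riesz
  representation theorem such a pair exists for every normal current; \<open>\<mu>\<close> is unique and \<open>\<tau>\<close> is
  unique \<open>\<mu>\<close>-almost everywhere. A Borel measure on the plane that is finite on compact sets is
  Radon, and \<open>\<mu>\<close>-measurability is measurability with respect to the completion of \<open>\<mu>\<close>.\<close>

definition polar_decomposition ::
  "((real^2 \<Rightarrow> real^2^2) \<Rightarrow> real) \<Rightarrow> (real^2) measure \<Rightarrow> (real^2 \<Rightarrow> real^2^2) \<Rightarrow> bool" where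
  "polar_decomposition T \<mu> \<tau> \<longleftrightarrow>
     sets \<mu> = sets borel \<and> (\<forall>K. compact K \<longrightarrow> emeasure \<mu> K < \<infinity>) \<and>
     \<tau> \<in> borel_measurable (completion \<mu>) \<and> (AE y in \<mu>. norm (\<tau> y) = 1) \<and>
     (\<forall>\<zeta>\<in>test_fun. T \<zeta> = (\<integral>y. \<zeta> y \<bullet> \<tau> y \<partial>completion \<mu>))"


definition ennreal_sqrt :: "ennreal \<Rightarrow> ennreal" where
  "ennreal_sqrt x = (if x = \<infinity> then \<infinity> else ennreal (sqrt (enn2real x)))"

definition F_star :: "(real^2 \<Rightarrow> real) \<Rightarrow> real^2 \<Rightarrow> real^2^2 \<Rightarrow> ennreal" where
  "F_star W y N =
     (if trace N = 0
      then ennreal (1/4 * W y * max ((norm N)\<^sup>2 - 2 * det N) ((N$1$2 - N$2$1)\<^sup>2))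
      else \<infinity>)"

text \<open>The \<open>F\<close>-mass of a current with polar decomposition \<open>\<mu>\<close>, \<open>\<tau>\<close>; by uniqueness of the
  decomposition it depends on the current only.\<close>

definition F_mass :: "(real^2 \<Rightarrow> real) \<Rightarrow> (real^2) measure \<Rightarrow> (real^2 \<Rightarrow> real^2^2) \<Rightarrow> ennreal" where
  "F_mass W \<mu> \<tau> = (\<integral>\<^sup>+ y. ennreal_sqrt (F_star W y (\<tau> y)) \<partial>completion \<mu>)"

end

theory Submission
  imports Defs
begin

text \<open>
  The proof is a calibration argument. If \<open>\<xi>\<close> is a vector field with
  \<open>D\<xi>(y) : N \<le> sqrt (F\<^sup>*(y, N))\<close> for all \<open>y\<close> and all \<open>N\<close> of trace \<open>0\<close>, then integrating against
  the current gives \<open>\<xi>\<^sub>1(a\<^sup>+) - \<xi>\<^sub>1(a\<^sup>-) = T(D\<xi>) \<le> M\<^sub>F(T)\<close>. The calibration is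
  \<open>\<xi> = 1/2 (d - \<partial>\<^sub>2h, - \<partial>\<^sub>1h)\<close>, where \<open>d(y)\<close> is the infimum of \<open>\<integral> sqrt W \<Theta>\<^sub>\<lambda>(\<gamma>') + \<partial>\<^sub>2\<^sub>2h \<gamma>'\<^sub>2 dt\<close>
  over piecewise differentiable curves \<open>\<gamma>\<close> from \<open>a\<^sup>-\<close> to \<open>y\<close>. Since \<open>d(a\<^sup>-) \<le> 0\<close> and the boundary
  terms of \<open>Z\<close> are increments of \<open>\<partial>\<^sub>2h\<close>, the left hand side is at least half the infimum of \<open>Z\<close>.
  If that infimum is \<open>- \<infinity>\<close>, there is nothing to prove; otherwise \<open>d\<close> is finite.

  The inequality for \<open>D\<xi>\<close> reduces to a pointwise one. Appending a short segment to a curve shows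
  that the derivative of \<open>d\<close> in direction \<open>z\<close> is at most \<open>sqrt W \<Theta>\<^sub>\<lambda>(z) + \<partial>\<^sub>2\<^sub>2h z\<^sub>2\<close>. For
  \<open>N = (a, b; c, -a)\<close> take \<open>z = (a, b)\<close>; as \<open>\<partial>\<^sub>1\<^sub>2h = \<partial>\<^sub>2\<^sub>1h\<close> and \<open>\<partial>\<^sub>1\<^sub>1h = - \<lambda> sqrt W\<close>, all other
  terms in \<open>D\<xi> : N\<close> cancel or combine to \<open>D\<xi> : N \<le> 1/2 sqrt W (\<Theta>\<^sub>\<lambda>(a, b) + \<lambda> c)\<close>. The function
  \<open>\<Theta>\<^sub>\<lambda>\<close> is exactly such that \<open>\<Theta>\<^sub>\<lambda>(a, b) + \<lambda> c \<le> max (sqrt (4a\<^sup>2 + (b + c)\<^sup>2)) \<bar>b - c\<bar>\<close> (lemma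
  \<open>Theta_le_max\<close>), and the right hand side times \<open>1/2 sqrt W\<close> is \<open>sqrt F\<^sup>*\<close> (lemma
  \<open>ennreal_sqrt_F_star\<close>).

  Two points need care. First, \<open>\<xi>\<close> is not smooth and \<open>\<lambda>\<close> is only Borel, while the measure \<open>\<parallel>T\<parallel>\<close>
  may be concentrated on a Lebesgue null set, so an inequality almost everywhere would not do.
  Convolution with a mollifier turns the increment estimate for \<open>d\<close> into a bound on the derivative
  of the smooth function \<open>d * \<eta>\<close> at every point, by \<open>sqrt W \<Theta>\<^sub>\<lambda>(z) + \<partial>\<^sub>2\<^sub>2h z\<^sub>2\<close> convolved with
  \<open>\<eta>\<close> (lemma \<open>derivative_convolution_le\<close>). The pointwise inequality can be used under the integral
  sign, where the dependence on \<open>\<lambda>\<close> disappears, and what remains is the convolution of the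
  continuous function \<open>sqrt W\<close>. Secondly, \<open>\<xi>\<close> does not have compact support. It grows at most like
  \<open>\<bar>y\<bar>\<close> to the power \<open>1 + p\<close>, so multiplying by a cutoff at scale \<open>R\<close> costs an error of order
  \<open>\<bar>y\<bar>\<close> to the power \<open>p\<close> on \<open>\<bar>y\<bar> \<ge> R\<close>; this is controlled by \<open>sqrt F\<^sup>*\<close>, and if \<open>M\<^sub>F(T)\<close> is
  finite, the tail of a convergent integral. Both limits are taken in theorem \<open>calibration_bound\<close>.
\<close>

section \<open>Differential calculus with iterated partial derivatives\<close>

lemma partial_eqI:
  assumes "(f has_derivative f') (at y)"
  shows "partial i f y = f' (axis i 1)"
  unfolding partial_def using frechet_derivative_at[OF assms] by simp

lemma has_derivative_partials:
  assumes "f differentiable (at y)"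
  shows "(f has_derivative (\<lambda>v. \<Sum>i\<in>UNIV. (v $ i) *\<^sub>R partial i f y)) (at y)"
proof -
  have d: "(f has_derivative frechet_derivative f (at y)) (at y)"
    using assms frechet_derivative_works by blast
  have lin: "linear (frechet_derivative f (at y))"
    using d has_derivative_linear by blast
  have "frechet_derivative f (at y) v = (\<Sum>i\<in>UNIV. (v $ i) *\<^sub>R partial i f y)" for v
  proof -
    have "v = (\<Sum>i\<in>UNIV. (v $ i) *\<^sub>R axis i 1)"
      using basis_expansion[of v] by (simp add: scalar_mult_eq_scaleR)
    then have "frechet_derivative f (at y) v
        = frechet_derivative f (at y) (\<Sum>i\<in>UNIV. (v $ i) *\<^sub>R axis i 1)" by simp
    then show ?thesis
      by (simp add: linear_sum[OF lin] linear_scale[OF lin] partial_def)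
  qed
  then show ?thesis using d by (metis (no_types, lifting) ext)
qed

text \<open>Reduces \<open>C\<^sup>j\<close> regularity of a function to that of its partial derivatives, when a formula
  for the derivative is known. All closure properties of \<^const>\<open>Cj\<close> below are inductions with this
  rule.\<close>

lemma Cj_SucI:
  assumes "\<And>y. (f has_derivative f' y) (at y)" "\<And>i. Cj j (\<lambda>y. f' y (axis i 1))"
  shows "Cj (Suc j) f"
proof -
  have "partial i f = (\<lambda>y. f' y (axis i 1))" for i
    using partial_eqI[OF assms(1)] by (rule ext)
  then show ?thesis using assms by (auto simp: differentiable_def)
qed

lemma Cj_Suc_imp: "Cj (Suc j) f \<Longrightarrow> Cj j f"
proof (induction j arbitrary: f)
  case 0
  then show ?case
    by (simp add: continuous_at_imp_continuous_on differentiable_imp_continuous_within)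
next
  case (Suc j)
  have "\<forall>i. Cj (Suc j) (partial i f)" "\<forall>y. f differentiable (at y)" using Suc.prems by auto
  then show ?case using Suc.IH by auto
qed

lemma Cj_continuous: "Cj j f \<Longrightarrow> continuous_on UNIV f"
  by (induction j) (auto intro: Cj_Suc_imp dest: Cj_Suc_imp simp del: Cj.simps(2))

lemma Cj_const: "Cj j (\<lambda>x. c)"
proof (induction j arbitrary: c)
  case (Suc j)
  show ?case by (rule Cj_SucI[where f'="\<lambda>_ _. 0"]) (auto simp: Suc)
qed auto

lemma Cj_coordinate: "Cj j (\<lambda>x. x $ k)"
proof (cases j)
  case (Suc j')
  show ?thesis unfolding Suc
    by (rule Cj_SucI[where f'="\<lambda>_ v. v $ k"])
       (auto intro!: bounded_linear_imp_has_derivative bounded_linear_vec_nth Cj_const)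
qed (auto intro!: continuous_intros)

lemma Cj_add: "Cj j f \<Longrightarrow> Cj j g \<Longrightarrow> Cj j (\<lambda>x. f x + g x)"
proof (induction j arbitrary: f g)
  case 0
  then show ?case by (auto intro!: continuous_intros)
next
  case (Suc j)
  have d: "(f has_derivative frechet_derivative f (at y)) (at y)"
    "(g has_derivative frechet_derivative g (at y)) (at y)" for y
    using Suc.prems by (simp_all add: frechet_derivative_works[symmetric])
  show ?case
  proof (rule Cj_SucI[OF has_derivative_add[OF d]])
    fix i
    have "Cj j (\<lambda>y. partial i f y + partial i g y)"
      using Suc.prems by (intro Suc.IH) auto
    then show "Cj j (\<lambda>y. frechet_derivative f (at y) (axis i 1) + frechet_derivative g (at y) (axis i 1))"
      by (simp add: partial_def)
  qed
qed

lemma Cj_scaleR: "Cj j f \<Longrightarrow> Cj j g \<Longrightarrow> Cj j (\<lambda>x. f x *\<^sub>R g x)"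
proof (induction j arbitrary: f g)
  case 0
  then show ?case by (auto intro!: continuous_intros)
next
  case (Suc j)
  have d: "(f has_derivative frechet_derivative f (at y)) (at y)"
    "(g has_derivative frechet_derivative g (at y)) (at y)" for y
    using Suc.prems by (simp_all add: frechet_derivative_works[symmetric])
  show ?case
  proof (rule Cj_SucI[OF has_derivative_scaleR[OF d]])
    fix i
    have "Cj j (\<lambda>y. f y *\<^sub>R partial i g y + partial i f y *\<^sub>R g y)"
      using Suc.prems Cj_Suc_imp[OF Suc.prems(1)] Cj_Suc_imp[OF Suc.prems(2)]
      by (intro Suc.IH Cj_add) auto
    then show "Cj j (\<lambda>y. f y *\<^sub>R frechet_derivative g (at y) (axis i 1)
        + frechet_derivative f (at y) (axis i 1) *\<^sub>R g y)"
      by (simp add: partial_def)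
  qed
qed

lemma Cj_sum: "(\<And>i. i \<in> I \<Longrightarrow> Cj j (f i)) \<Longrightarrow> Cj j (\<lambda>x. \<Sum>i\<in>I. f i x)"
  by (induction I rule: infinite_finite_induct) (auto intro!: Cj_add Cj_const)

lemma Cj_dilation: "Cj j f \<Longrightarrow> Cj j (\<lambda>x. f (c *\<^sub>R x))"
proof (induction j arbitrary: f)
  case 0
  then show ?case by (auto intro!: continuous_intros continuous_on_compose2[of UNIV f])
next
  case (Suc j)
  have d: "(f has_derivative frechet_derivative f (at y)) (at y)" for y
    using Suc.prems frechet_derivative_works by auto
  have s: "((\<lambda>x. c *\<^sub>R x) has_derivative (\<lambda>x. c *\<^sub>R x)) (at y)" for y :: "real^2"
    by (auto intro!: derivative_eq_intros)
  show ?case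
  proof (rule Cj_SucI[OF has_derivative_compose[OF s d]])
    fix i
    have "Cj j (\<lambda>y. c *\<^sub>R partial i f (c *\<^sub>R y))"
      using Suc.prems by (intro Cj_scaleR Cj_const Suc.IH) auto
    moreover have "linear (frechet_derivative f (at (c *\<^sub>R y)))" for y
      using d has_derivative_linear by blast
    ultimately show "Cj j (\<lambda>y. frechet_derivative f (at (c *\<^sub>R y)) (c *\<^sub>R axis i 1))"
      by (simp add: partial_def linear_scale)
  qed
qed

text \<open>The set of points of norm greater than \<open>r\<close> is open, so vanishing there passes to
  derivatives. Supports are recorded in this form throughout, which avoids closures of supports.\<close>

lemma vanishing_partial:
  assumes "\<And>x. r < norm x \<Longrightarrow> f x = 0" "r < norm y"
  shows "partial i f y = 0"
proof -
  have "((\<lambda>x. 0) has_derivative (\<lambda>x. 0)) (at y)" by simp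
  then have "(f has_derivative (\<lambda>x. 0)) (at y)"
    by (rule has_derivative_transform_within_open[where s="{x. r < norm x}"])
       (use assms in \<open>auto intro!: open_Collect_less continuous_intros\<close>)
  then show ?thesis by (rule partial_eqI)
qed

lemma test_funI:
  assumes "\<And>j. Cj j f" "\<And>x. r < norm x \<Longrightarrow> f x = 0"
  shows "f \<in> test_fun"
proof -
  have "{x. f x \<noteq> 0} \<subseteq> cball 0 r" using assms(2) by (force simp: not_le)
  then have "bounded {x. f x \<noteq> 0}" using bounded_cball bounded_subset by blast
  then show ?thesis using assms by (simp add: test_fun_def)
qed

lemma jacobian_eq_partials:
  fixes f :: "real^2 \<Rightarrow> real^2"
  assumes "f differentiable (at y)"
  shows "jacobian f (at y) $ i $ k = partial k (\<lambda>x. f x $ i) y"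
proof -
  have d: "(f has_derivative frechet_derivative f (at y)) (at y)"
    using assms frechet_derivative_works by blast
  have "((\<lambda>x. f x $ i) has_derivative (\<lambda>v. frechet_derivative f (at y) v $ i)) (at y)"
    using bounded_linear.has_derivative[OF bounded_linear_vec_nth d] .
  then have "partial k (\<lambda>x. f x $ i) y = frechet_derivative f (at y) (axis k 1) $ i"
    by (rule partial_eqI)
  then show ?thesis by (simp add: jacobian_def matrix_def)
qed

lemma Cj_vector: 
  fixes f :: "real^2 \<Rightarrow> real^2"
  assumes "\<And>i. Cj j (\<lambda>x. f x $ i)"
  shows "Cj j f"
proof -
  have "Cj j (\<lambda>x. \<Sum>i\<in>UNIV. (f x $ i) *\<^sub>R (axis i 1 :: real^2))"
    by (intro Cj_sum Cj_scaleR assms Cj_const)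
  moreover have "(\<Sum>i\<in>UNIV. (f x $ i) *\<^sub>R axis i 1) = f x" for x
    using basis_expansion[of "f x"] by (simp add: scalar_mult_eq_scaleR)
  ultimately show ?thesis by (simp only:)
qed

lemma jacobian_test_fun:
  fixes f :: "real^2 \<Rightarrow> real^2"
  assumes C: "\<And>i j. Cj j (\<lambda>x. f x $ i)" and van: "\<And>x. r < norm x \<Longrightarrow> f x = 0"
  shows "(\<lambda>x. jacobian f (at x)) \<in> test_fun"
proof (rule test_funI)
  have diff: "f differentiable (at y)" for y
    using Cj_vector[OF C, of "Suc 0"] by auto
  fix j
  have "Cj j (\<lambda>x. \<Sum>i\<in>UNIV. \<Sum>k\<in>UNIV. partial k (\<lambda>x. f x $ i) x *\<^sub>R (axis i (axis k 1) :: real^2^2))"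
    using C[of "Suc j"] by (intro Cj_sum Cj_scaleR Cj_const) auto
  moreover have "jacobian f (at x) = (\<Sum>i\<in>UNIV. \<Sum>k\<in>UNIV. partial k (\<lambda>x. f x $ i) x *\<^sub>R axis i (axis k 1))" for x
    by (simp add: vec_eq_iff sum_2 forall_2 axis_def jacobian_eq_partials[OF diff])
  ultimately show "Cj j (\<lambda>x. jacobian f (at x))" by simp
next
  fix x assume x: "r < norm (x::real^2)"
  have "f differentiable (at y)" for y
    using Cj_vector[OF C, of "Suc 0"] by auto
  then have "jacobian f (at x) $ i $ k = 0" for i k
    using vanishing_partial[OF _ x, of "\<lambda>x. f x $ i" k] van by (simp add: jacobian_eq_partials)
  then show "jacobian f (at x) = 0" by (simp add: vec_eq_iff)
qed

section \<open>A smooth bump function\<close>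

text \<open>The family \<open>u\<^sup>-\<^sup>k exp(-1/u)\<close>, extended by \<open>0\<close> to \<open>u \<le> 0\<close>. It contains the standard flat
  function (\<open>k = 0\<close>), and the derivative of each member is a linear combination of two other
  members; so smoothness follows by induction.\<close>

definition flat :: "nat \<Rightarrow> real \<Rightarrow> real" where
  "flat k u = (if u \<le> 0 then 0 else inverse u ^ k * exp (- inverse u))"

lemma flat_tendsto_0: "(flat k \<longlongrightarrow> 0) (at 0)"
proof -
  have "((\<lambda>x. x ^ k / exp x) \<longlongrightarrow> (0::real)) at_top"
    by (rule tendsto_power_div_exp_0)
  then have "((\<lambda>u. inverse u ^ k / exp (inverse u)) \<longlongrightarrow> (0::real)) (at_right 0)"
    by (rule filterlim_compose[OF _ filterlim_inverse_at_top_right])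
  then have r: "(flat k \<longlongrightarrow> 0) (at_right 0)"
    by (rule Lim_transform_eventually)
       (auto simp: flat_def eventually_at_filter exp_minus divide_inverse)
  have l: "(flat k \<longlongrightarrow> 0) (at_left 0)"
    by (rule Lim_transform_eventually[OF tendsto_const])
       (auto simp: flat_def eventually_at_filter)
  show ?thesis using l r filterlim_split_at by blast
qed

lemma flat_deriv: "(flat k has_real_derivative flat (k+2) u - k * flat (k+1) u) (at u)"
proof -
  consider "u < 0" | "u = 0" | "u > 0" by linarith
  then show ?thesis
  proof cases
    case 1
    have "((\<lambda>x. 0) has_real_derivative 0) (at u)" by simp
    then have "(flat k has_real_derivative 0) (at u)"
      by (rule has_field_derivative_transform_within_open[where S="{..<0}"])
         (use 1 in \<open>auto simp: flat_def\<close>)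
    then show ?thesis using 1 by (simp add: flat_def)
  next
    case 2
    have "(\<lambda>h. (flat k (0 + h) - flat k 0) / h) = flat (k+1)"
      by (auto simp: flat_def fun_eq_iff divide_inverse)
    then have "(flat k has_real_derivative 0) (at 0)"
      using flat_tendsto_0[of "k+1"] by (simp add: DERIV_def)
    then show ?thesis using 2 by (simp add: flat_def)
  next
    case 3
    have "((\<lambda>u. inverse u ^ k * exp (- inverse u)) has_real_derivative
        (inverse u ^ k * (exp (- inverse u) * inverse u ^ 2)
         + (real k * (- (inverse u ^ 2) * inverse u ^ (k - 1))) * exp (- inverse u))) (at u)"
      using 3 by (auto intro!: derivative_eq_intros simp: power2_eq_square)
    moreover have "inverse u ^ k * (exp (- inverse u) * inverse u ^ 2)
         + (real k * (- (inverse u ^ 2) * inverse u ^ (k - 1))) * exp (- inverse u)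
        = flat (k+2) u - k * flat (k+1) u"
      using 3 by (cases k) (auto simp: flat_def power2_eq_square algebra_simps)
    ultimately have "((\<lambda>u. inverse u ^ k * exp (- inverse u)) has_real_derivative
        flat (k+2) u - k * flat (k+1) u) (at u)" by simp
    then show ?thesis
      by (rule has_field_derivative_transform_within_open[where S="{0<..}"])
         (use 3 in \<open>auto simp: flat_def\<close>)
  qed
qed

lemma Cj_flat: "Cj j (\<lambda>x. flat k (c - x \<bullet> x))"
proof (induction j arbitrary: k)
  case 0
  have "isCont (flat k) u" for u using DERIV_isCont[OF flat_deriv] .
  then have "continuous_on UNIV (flat k)" by (simp add: continuous_at_imp_continuous_on)
  then show ?case
    by (auto intro!: continuous_on_compose2[of UNIV "flat k"] continuous_intros)
next
  case (Suc j)
  let ?D = "\<lambda>x::real^2. flat (k+2) (c - x \<bullet> x) - k * flat (k+1) (c - x \<bullet> x)"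
  have d: "((\<lambda>x. flat k (c - x \<bullet> x)) has_derivative (\<lambda>v. (- 2 * (x \<bullet> v)) * ?D x)) (at x)" for x :: "real^2"
  proof -
    have "((\<lambda>x. c - x \<bullet> x) has_derivative (\<lambda>v. - 2 * (x \<bullet> v))) (at x)"
      by (auto intro!: derivative_eq_intros simp: inner_commute)
    from has_derivative_compose[OF this flat_deriv[of k, unfolded has_field_derivative_def]]
    show ?thesis by (simp add: mult.commute)
  qed
  show ?case
  proof (rule Cj_SucI[OF d])
    fix i
    have "Cj j (\<lambda>x. ((- 2) *\<^sub>R (x $ i)) *\<^sub>R (flat (k+2) (c - x \<bullet> x) + (- real k) *\<^sub>R flat (k+1) (c - x \<bullet> x)))"
      by (intro Cj_scaleR Cj_add Cj_const Cj_coordinate Suc.IH)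
    then show "Cj j (\<lambda>x. (- 2 * (x \<bullet> axis i 1)) * ?D x)"
      by (simp add: inner_axis)
  qed
qed

section \<open>The algebra of the calibration\<close>

text \<open>For matrices of trace \<open>0\<close> this is the norm that is dual, up to the factor \<open>2\<close>, to the
  seminorm \<open>M \<mapsto> sqrt ((m\<^sub>1\<^sub>1 - m\<^sub>2\<^sub>2)\<^sup>2 + (m\<^sub>1\<^sub>2 + m\<^sub>2\<^sub>1)\<^sup>2) + \<bar>m\<^sub>1\<^sub>2 - m\<^sub>2\<^sub>1\<bar>\<close>. The quantity
  \<open>sqrt (F\<^sup>*(y, N))\<close> equals \<open>1/2 sqrt (W(y)) dual_norm N\<close>.\<close>

definition dual_norm :: "real^2^2 \<Rightarrow> real" where
  "dual_norm N = max (sqrt (4 * (N$1$1)\<^sup>2 + (N$1$2 + N$2$1)\<^sup>2)) \<bar>N$1$2 - N$2$1\<bar>"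

text \<open>The duality behind \<^const>\<open>dual_norm\<close>. In the coordinates \<open>(2a, b + c)\<close> and \<open>b - c\<close> the pairing on
  the left splits into a planar inner product and a scalar product.\<close>

lemma rotated_cauchy_schwarz:
  fixes p q r a b c :: real
  assumes "sqrt (p\<^sup>2 + q\<^sup>2) + \<bar>r\<bar> \<le> 2"
  shows "p * a + (q + r) / 2 * b + (q - r) / 2 * c \<le> max (sqrt (4 * a\<^sup>2 + (b + c)\<^sup>2)) \<bar>b - c\<bar>"
proof -
  define m where "m = max (sqrt (4 * a\<^sup>2 + (b + c)\<^sup>2)) \<bar>b - c\<bar>"
  have "p * (2 * a) + q * (b + c) \<le> sqrt (p\<^sup>2 + q\<^sup>2) * sqrt (4 * a\<^sup>2 + (b + c)\<^sup>2)"
  proof -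
    have "(vector [p, q] :: real^2) \<bullet> vector [2 * a, b + c]
        \<le> norm (vector [p, q] :: real^2) * norm (vector [2 * a, b + c] :: real^2)"
      by (rule norm_cauchy_schwarz)
    then show ?thesis
      by (simp add: inner_vec_def norm_vec_def L2_set_def sum_2 power_mult_distrib)
  qed
  also have "\<dots> \<le> sqrt (p\<^sup>2 + q\<^sup>2) * m"
    by (intro mult_left_mono) (auto simp: m_def)
  finally have 1: "p * (2 * a) + q * (b + c) \<le> sqrt (p\<^sup>2 + q\<^sup>2) * m" .
  have "r * (b - c) \<le> \<bar>r\<bar> * \<bar>b - c\<bar>" by (metis abs_ge_self abs_mult)
  also have "\<dots> \<le> \<bar>r\<bar> * m" by (intro mult_left_mono) (auto simp: m_def)
  finally have 2: "r * (b - c) \<le> \<bar>r\<bar> * m" .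
  have "0 \<le> m" by (simp add: m_def max_def)
  then have le: "(sqrt (p\<^sup>2 + q\<^sup>2) + \<bar>r\<bar>) * m \<le> 2 * m" using assms by (intro mult_right_mono)
  have eq: "2 * (p * a + (q + r) / 2 * b + (q - r) / 2 * c) = p * (2 * a) + q * (b + c) + r * (b - c)"
    by (simp add: field_simps)
  from le have "2 * (p * a + (q + r) / 2 * b + (q - r) / 2 * c) \<le> 2 * m"
    unfolding eq using 1 2 by (simp only: distrib_right)
  then show ?thesis by (simp add: m_def)
qed

text \<open>\<open>\<Theta>\<^sub>l\<close> is the support function of the set of all \<open>(p, q)\<close> with
  \<open>sqrt (p\<^sup>2 + (q + l)\<^sup>2) + \<bar>q - l\<bar> \<le> 2\<close>, a region between two parabolas that meet at height
  \<open>q = l\<close>. The three cases in its definition say whether the maximum is attained on the upper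
  parabola, on the lower one, or at a corner; the lemma names the maximizer.\<close>

lemma Theta_eq_linear:
  assumes l: "l \<in> {-1..1}"
  obtains p q where "Theta l z = p * z$1 + q * z$2" "sqrt (p\<^sup>2 + (q + l)\<^sup>2) + \<bar>q - l\<bar> \<le> 2"
proof -
  have key: "sqrt (p\<^sup>2 + (q + l)\<^sup>2) + \<bar>q - l\<bar> \<le> 2"
    if "p\<^sup>2 + (q + l)\<^sup>2 \<le> (2 - \<bar>q - l\<bar>)\<^sup>2" "\<bar>q - l\<bar> \<le> 2" for p q
    using real_le_lsqrt[OF _ that(1)] that(2) by simp
  consider "z$2 > 0 \<and> (1 + l) * (z$1)\<^sup>2 < (1 - l) * (z$2)\<^sup>2"
    | "z$2 < 0 \<and> (1 - l) * (z$1)\<^sup>2 < (1 + l) * (z$2)\<^sup>2"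
    | "\<not> (z$2 > 0 \<and> (1 + l) * (z$1)\<^sup>2 < (1 - l) * (z$2)\<^sup>2)"
      "\<not> (z$2 < 0 \<and> (1 - l) * (z$1)\<^sup>2 < (1 + l) * (z$2)\<^sup>2)" by blast
  then show ?thesis
  proof cases
    case 1
    define u where "u = z$1 / z$2"
    have z1: "z$1 = u * z$2" using 1 by (simp add: u_def)
    \<comment> \<open>the point of the upper parabola \<open>p\<^sup>2 = 4 (1 + l) (1 - q)\<close> with normal direction \<open>(u, 1)\<close>\<close>
    define q where "q = 1 - (1 + l) * u\<^sup>2"
    define p where "p = 2 * (1 + l) * u"
    have "(1 + l) * u\<^sup>2 * (z$2)\<^sup>2 < (1 - l) * (z$2)\<^sup>2"
      using 1 by (simp add: z1 power_mult_distrib mult.assoc)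
    then have "(1 + l) * u\<^sup>2 < 1 - l" using 1 by simp
    moreover have "0 \<le> (1 + l) * u\<^sup>2" using l by auto
    ultimately have q: "l < q" "q \<le> 1" by (auto simp: q_def)
    have "p\<^sup>2 + (q + l)\<^sup>2 = (2 - (q - l))\<^sup>2"
      by (simp add: p_def q_def power2_eq_square algebra_simps)
    then have "sqrt (p\<^sup>2 + (q + l)\<^sup>2) + \<bar>q - l\<bar> \<le> 2" using q l by (intro key) auto
    moreover have "Theta l z = p * z$1 + q * z$2"
      using 1 by (simp add: Theta_def z1 p_def q_def power2_eq_square field_simps)
    ultimately show ?thesis using that by blast
  next
    case 2
    define u where "u = z$1 / z$2"
    have z1: "z$1 = u * z$2" using 2 by (simp add: u_def)
    \<comment> \<open>the point of the lower parabola \<open>p\<^sup>2 = 4 (1 - l) (1 + q)\<close> with normal direction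
      \<open>(- u, - 1)\<close>\<close>
    define q where "q = - (1 - (1 - l) * u\<^sup>2)"
    define p where "p = - 2 * (1 - l) * u"
    have "(1 - l) * u\<^sup>2 * (z$2)\<^sup>2 < (1 + l) * (z$2)\<^sup>2"
      using 2 by (simp add: z1 power_mult_distrib mult.assoc)
    then have "(1 - l) * u\<^sup>2 < 1 + l" using 2 by simp
    moreover have "0 \<le> (1 - l) * u\<^sup>2" using l by auto
    ultimately have q: "q < l" "-1 \<le> q" by (auto simp: q_def)
    have "p\<^sup>2 + (q + l)\<^sup>2 = (2 - (l - q))\<^sup>2"
      by (simp add: p_def q_def power2_eq_square algebra_simps)
    then have "sqrt (p\<^sup>2 + (q + l)\<^sup>2) + \<bar>q - l\<bar> \<le> 2" using q l by (intro key) auto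
    moreover have "Theta l z = p * z$1 + q * z$2"
      using 2 by (simp add: Theta_def z1 p_def q_def power2_eq_square field_simps)
    ultimately show ?thesis using that by blast
  next
    case 3
    \<comment> \<open>the corners have \<open>q = l\<close>\<close>
    define p where "p = 2 * sgn (z$1) * sqrt (1 - l\<^sup>2)"
    have l2: "l\<^sup>2 \<le> 1" using l by (simp add: abs_square_le_1 abs_le_iff)
    have "(sgn (z$1))\<^sup>2 \<le> 1" by (simp add: sgn_if)
    then have "(sgn (z$1))\<^sup>2 * (1 - l\<^sup>2) \<le> 1 * (1 - l\<^sup>2)" using l2 by (intro mult_right_mono) auto
    then have "p\<^sup>2 + (l + l)\<^sup>2 \<le> (2 - \<bar>l - l\<bar>)\<^sup>2"
      using l2 by (simp add: p_def power_mult_distrib)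
    then have "sqrt (p\<^sup>2 + (l + l)\<^sup>2) + \<bar>l - l\<bar> \<le> 2" by (intro key) auto
    moreover have "Theta l z = p * z$1 + l * z$2"
      using 3 by (auto simp: Theta_def p_def abs_sgn mult_ac)
    ultimately show ?thesis using that by blast
  qed
qed

text \<open>The pointwise inequality that makes the vector field of the introduction a calibration. It
  follows because the maximizer \<open>(p, q)\<close> from \<open>Theta_eq_linear\<close> satisfies the dual constraint.\<close>

lemma Theta_le_max:
  assumes l: "l \<in> {-1..1}"
  shows "Theta l z + l * c \<le> max (sqrt (4 * (z$1)\<^sup>2 + (z$2 + c)\<^sup>2)) \<bar>z$2 - c\<bar>"
proof -
  obtain p q where pq: "Theta l z = p * z$1 + q * z$2" "sqrt (p\<^sup>2 + (q + l)\<^sup>2) + \<bar>q - l\<bar> \<le> 2"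
    using Theta_eq_linear[OF l] by blast
  have "p * z$1 + ((q + l) + (q - l)) / 2 * z$2 + ((q + l) - (q - l)) / 2 * c
      \<le> max (sqrt (4 * (z$1)\<^sup>2 + (z$2 + c)\<^sup>2)) \<bar>z$2 - c\<bar>"
    by (rule rotated_cauchy_schwarz[OF pq(2)])
  then show ?thesis using pq(1) by simp
qed

lemma abs_Theta_le:
  assumes l: "l \<in> {-1..1}"
  shows "\<bar>Theta l z\<bar> \<le> 2 * norm z"
proof -
  have n: "norm z = sqrt ((z$1)\<^sup>2 + (z$2)\<^sup>2)" by (simp add: norm_vec_def L2_set_def sum_2)
  have "sqrt (4 * (z$1)\<^sup>2 + (z$2)\<^sup>2) \<le> sqrt (4 * ((z$1)\<^sup>2 + (z$2)\<^sup>2))" by simp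
  also have "\<dots> = 2 * norm z" unfolding n real_sqrt_mult by simp
  finally have up: "Theta l z \<le> 2 * norm z"
    using Theta_le_max[OF l, of z 0] component_le_norm_cart[of z 2] by (simp split: if_splits)
  have "\<bar>l * z$2\<bar> \<le> 1 * \<bar>z$2\<bar>" unfolding abs_mult using l by (intro mult_right_mono) auto
  then have "- norm z \<le> l * z$2" using component_le_norm_cart[of z 2] by simp
  moreover have "0 \<le> (1 + l) * ((z$1)\<^sup>2 / \<bar>z$2\<bar>)" "0 \<le> (1 - l) * ((z$1)\<^sup>2 / \<bar>z$2\<bar>)"
    using l by auto
  moreover have "0 \<le> 2 * \<bar>z$1\<bar> * sqrt (1 - l\<^sup>2)" using l by (simp add: abs_square_le_1 abs_le_iff)
  ultimately have "- (2 * norm z) \<le> Theta l z"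
    using norm_ge_zero[of z] abs_ge_zero[of "z$2"] unfolding Theta_def by (smt (verit))
  then show ?thesis using up by simp
qed

lemma Theta_scale:
  assumes "0 \<le> t"
  shows "Theta l (t *\<^sub>R z) = t * Theta l z"
proof (cases "t = 0")
  case True
  then show ?thesis by (simp add: Theta_def)
next
  case False
  then have t: "0 < t" using assms by simp
  have "k * (t * x)\<^sup>2 < m * (t * y)\<^sup>2 \<longleftrightarrow> k * x\<^sup>2 < m * y\<^sup>2" for k m x y :: real
  proof -
    have "k * (t * x)\<^sup>2 < m * (t * y)\<^sup>2 \<longleftrightarrow> t\<^sup>2 * (k * x\<^sup>2) < t\<^sup>2 * (m * y\<^sup>2)"
      by (simp add: power_mult_distrib mult_ac)
    then show ?thesis using t by simp
  qed
  note cmp = this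
  have quot: "(t * x)\<^sup>2 / \<bar>t * y\<bar> = t * (x\<^sup>2 / \<bar>y\<bar>)" for x y
    using t by (simp add: abs_mult power2_eq_square)
  have sgn: "0 < t * y \<longleftrightarrow> 0 < y" "t * y < 0 \<longleftrightarrow> y < 0" "\<bar>t * y\<bar> = t * \<bar>y\<bar>" for y
    using t by (auto simp: zero_less_mult_iff mult_less_0_iff abs_mult)
  show ?thesis
    unfolding Theta_def vector_scaleR_component real_scaleR_def quot cmp
    unfolding sgn by (simp add: distrib_left right_diff_distrib mult.left_commute)
qed

lemma Theta_measurable [measurable]:
  assumes [measurable]: "f \<in> borel_measurable M"
  shows "(\<lambda>x. Theta (f x) z) \<in> borel_measurable M"
  unfolding Theta_def by measurable

lemma dual_norm_trace_free:
  assumes "trace N = 0"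
  shows "norm N \<le> dual_norm N" "dual_norm N \<le> 2 * norm N"
    "dual_norm N = sqrt (max ((norm N)\<^sup>2 - 2 * det N) ((N$1$2 - N$2$1)\<^sup>2))"
proof -
  have t: "N$2$2 = - N$1$1" using assms by (simp add: trace_def sum_2)
  have n: "(norm N)\<^sup>2 = 2 * (N$1$1)\<^sup>2 + (N$1$2)\<^sup>2 + (N$2$1)\<^sup>2"
    by (simp only: power2_norm_eq_inner inner_vec_def sum_2 t inner_real_def) (simp add: power2_eq_square)
  have s: "(norm N)\<^sup>2 - 2 * det N = 4 * (N$1$1)\<^sup>2 + (N$1$2 + N$2$1)\<^sup>2"
    unfolding n by (simp add: det_2 t power2_eq_square algebra_simps)
  have sm: "sqrt (max x y) = max (sqrt x) (sqrt y)" for x y by (auto simp: max_def)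
  show eq: "dual_norm N = sqrt (max ((norm N)\<^sup>2 - 2 * det N) ((N$1$2 - N$2$1)\<^sup>2))"
    unfolding s sm dual_norm_def by simp
  define x y where "x = 4 * (N$1$1)\<^sup>2 + (N$1$2 + N$2$1)\<^sup>2" and "y = (N$1$2 - N$2$1)\<^sup>2"
  have xy: "x + y = 4 * (N$1$1)\<^sup>2 + 2 * (N$1$2)\<^sup>2 + 2 * (N$2$1)\<^sup>2" "0 \<le> x" "0 \<le> y"
    by (simp_all add: x_def y_def) (simp add: power2_eq_square algebra_simps)
  have d: "dual_norm N = sqrt (max x y)" unfolding eq s x_def y_def ..
  have "0 \<le> (N$1$1)\<^sup>2" "0 \<le> (N$1$2)\<^sup>2" "0 \<le> (N$2$1)\<^sup>2" by auto
  then have "(norm N)\<^sup>2 \<le> max x y" "max x y \<le> (2 * norm N)\<^sup>2"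
    using xy by (auto simp: n power_mult_distrib)
  then show "norm N \<le> dual_norm N" "dual_norm N \<le> 2 * norm N"
    unfolding d by (auto intro: real_le_rsqrt real_le_lsqrt)
qed

text \<open>A second difference of \<open>h\<close> over a small square is, by the mean value theorem applied in each
  variable, a value of the mixed derivative. The difference is symmetric in \<open>i\<close> and \<open>k\<close>, which
  gives Schwarz' theorem next.\<close>

lemma second_difference:
  fixes h :: "real^2 \<Rightarrow> real"
  assumes h: "\<And>y. h differentiable (at y)" and hi: "\<And>y. partial i h differentiable (at y)"
    and s: "0 < s"
  obtains \<rho> \<sigma> where "0 < \<rho>" "\<rho> < s" "0 < \<sigma>" "\<sigma> < s"
    "h (y + s *\<^sub>R axis i 1 + s *\<^sub>R axis k 1) - h (y + s *\<^sub>R axis i 1) - h (y + s *\<^sub>R axis k 1) + h y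
      = s\<^sup>2 * partial k (partial i h) (y + \<rho> *\<^sub>R axis i 1 + \<sigma> *\<^sub>R axis k 1)"
proof -
  have line: "((\<lambda>r. f (x + r *\<^sub>R axis j 1)) has_real_derivative partial j f (x + r *\<^sub>R axis j 1)) (at r)"
    if "\<And>y. f differentiable (at y)" for f :: "real^2 \<Rightarrow> real" and x j r
  proof -
    have 1: "((\<lambda>r. x + r *\<^sub>R axis j 1) has_derivative (\<lambda>r. r *\<^sub>R axis j 1)) (at r)"
      by (auto intro!: derivative_eq_intros)
    have 2: "(f has_derivative frechet_derivative f (at (x + r *\<^sub>R axis j 1))) (at (x + r *\<^sub>R axis j 1))"
      using that frechet_derivative_works by blast
    have "linear (frechet_derivative f (at (x + r *\<^sub>R axis j 1)))" using 2 has_derivative_linear by blast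
    then show ?thesis using has_derivative_compose[OF 1 2]
      by (simp add: has_field_derivative_def linear_scale partial_def mult_commute_abs)
  qed
  define \<phi> where "\<phi> r = h (y + s *\<^sub>R axis k 1 + r *\<^sub>R axis i 1) - h (y + r *\<^sub>R axis i 1)" for r
  have "(\<phi> has_real_derivative
      (partial i h (y + s *\<^sub>R axis k 1 + r *\<^sub>R axis i 1) - partial i h (y + r *\<^sub>R axis i 1))) (at r)" for r
    unfolding \<phi>_def by (intro DERIV_diff line h)
  from MVT2[OF s this] obtain \<rho> where \<rho>: "0 < \<rho>" "\<rho> < s"
    "\<phi> s - \<phi> 0 = s * (partial i h (y + s *\<^sub>R axis k 1 + \<rho> *\<^sub>R axis i 1) - partial i h (y + \<rho> *\<^sub>R axis i 1))"
    by auto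
  from MVT2[OF s line[OF hi], of "y + \<rho> *\<^sub>R axis i 1" k] obtain \<sigma> where \<sigma>: "0 < \<sigma>" "\<sigma> < s"
    "partial i h (y + \<rho> *\<^sub>R axis i 1 + s *\<^sub>R axis k 1) - partial i h (y + \<rho> *\<^sub>R axis i 1 + 0 *\<^sub>R axis k 1)
      = s * partial k (partial i h) (y + \<rho> *\<^sub>R axis i 1 + \<sigma> *\<^sub>R axis k 1)"
    by auto
  show ?thesis
    by (rule that[of \<rho> \<sigma>]) (use \<rho> \<sigma> in \<open>auto simp: \<phi>_def power2_eq_square algebra_simps\<close>)
qed

text \<open>The two rows of \<open>D\<xi>\<close> contain \<open>\<partial>\<^sub>1\<^sub>2h\<close> and \<open>\<partial>\<^sub>2\<^sub>1h\<close>; they cancel in \<open>D\<xi> : N\<close> because they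
  agree.\<close>

lemma partial_commute:
  fixes h :: "real^2 \<Rightarrow> real"
  assumes h: "Cj 2 h"
  shows "partial k (partial i h) y = partial i (partial k h) y"
proof -
  have h0: "\<And>y. h differentiable (at y)" and h1: "\<And>i y. partial i h differentiable (at y)"
    and h2: "\<And>i k. continuous_on UNIV (partial k (partial i h))"
    using h by (auto simp: numeral_2_eq_2)
  define A B where "A = partial k (partial i h)" and "B = partial i (partial k h)"
  have "\<bar>A y - B y\<bar> \<le> 0 + e" if "e > 0" for e
  proof -
    have "isCont A y" "isCont B y"
      using h2 by (simp_all add: A_def B_def continuous_on_eq_continuous_at)
    then obtain d1 d2 where d: "d1 > 0" "d2 > 0" "\<And>u. dist u y < d1 \<Longrightarrow> dist (A u) (A y) < e/2"
      "\<And>u. dist u y < d2 \<Longrightarrow> dist (B u) (B y) < e/2"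
      unfolding continuous_at_eps_delta by (metis half_gt_zero[OF \<open>0 < e\<close>])
    define s where "s = min d1 d2 / 2"
    have s: "0 < s" using d by (simp add: s_def)
    have near: "dist (y + \<rho> *\<^sub>R axis i 1 + \<sigma> *\<^sub>R axis k 1) y < min d1 d2"
      if "0 < \<rho>" "\<rho> < s" "0 < \<sigma>" "\<sigma> < s" for \<rho> \<sigma> i k
    proof -
      have "dist (y + \<rho> *\<^sub>R axis i 1 + \<sigma> *\<^sub>R axis k 1) y = norm (\<rho> *\<^sub>R axis i (1::real) + \<sigma> *\<^sub>R axis k 1)"
        by (simp add: dist_norm)
      also have "\<dots> \<le> \<rho> + \<sigma>" using norm_triangle_ineq[of "\<rho> *\<^sub>R axis i (1::real)" "\<sigma> *\<^sub>R axis k 1"] that by simp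
      finally show ?thesis using that by (simp add: s_def)
    qed
    from second_difference[OF h0 h1 s, of y i k] obtain \<rho> \<sigma> where 1: "0 < \<rho>" "\<rho> < s" "0 < \<sigma>" "\<sigma> < s"
      "h (y + s *\<^sub>R axis i 1 + s *\<^sub>R axis k 1) - h (y + s *\<^sub>R axis i 1) - h (y + s *\<^sub>R axis k 1) + h y
        = s\<^sup>2 * A (y + \<rho> *\<^sub>R axis i 1 + \<sigma> *\<^sub>R axis k 1)"
      unfolding A_def by metis
    from second_difference[OF h0 h1 s, of y k i] obtain \<rho>' \<sigma>' where 2: "0 < \<rho>'" "\<rho>' < s" "0 < \<sigma>'" "\<sigma>' < s"
      "h (y + s *\<^sub>R axis k 1 + s *\<^sub>R axis i 1) - h (y + s *\<^sub>R axis k 1) - h (y + s *\<^sub>R axis i 1) + h y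
        = s\<^sup>2 * B (y + \<rho>' *\<^sub>R axis k 1 + \<sigma>' *\<^sub>R axis i 1)"
      unfolding B_def by metis
    have "s\<^sup>2 * A (y + \<rho> *\<^sub>R axis i 1 + \<sigma> *\<^sub>R axis k 1) = s\<^sup>2 * B (y + \<rho>' *\<^sub>R axis k 1 + \<sigma>' *\<^sub>R axis i 1)"
      using 1(5) 2(5) add.commute[of "s *\<^sub>R axis k (1::real)" "s *\<^sub>R axis i 1"]
      by (simp only: add.assoc)
    then have "A (y + \<rho> *\<^sub>R axis i 1 + \<sigma> *\<^sub>R axis k 1) = B (y + \<rho>' *\<^sub>R axis k 1 + \<sigma>' *\<^sub>R axis i 1)"
      using s by simp
    moreover have "\<bar>A (y + \<rho> *\<^sub>R axis i 1 + \<sigma> *\<^sub>R axis k 1) - A y\<bar> < e/2"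
      using d(3) near[OF 1(1-4), of i k] by (simp add: dist_real_def)
    moreover have "\<bar>B (y + \<rho>' *\<^sub>R axis k 1 + \<sigma>' *\<^sub>R axis i 1) - B y\<bar> < e/2"
      using d(4) near[OF 2(1-4), of k i] by (simp add: dist_real_def)
    ultimately show ?thesis by linarith
  qed
  then have "\<bar>A y - B y\<bar> \<le> 0" by (rule field_le_epsilon)
  then show ?thesis by (simp add: A_def B_def)
qed

section \<open>Convolution with smooth kernels of compact support\<close>

definition locally_bounded :: "(real^2 \<Rightarrow> real) \<Rightarrow> bool" where
  "locally_bounded g \<longleftrightarrow> (\<forall>r. \<exists>B. \<forall>x. norm x \<le> r \<longrightarrow> \<bar>g x\<bar> \<le> B)"

lemma locally_boundedD:
  assumes "locally_bounded g"
  obtains B where "0 \<le> B" "\<And>x. norm x \<le> r \<Longrightarrow> \<bar>g x\<bar> \<le> B"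
proof -
  obtain B where "\<And>x. norm x \<le> r \<Longrightarrow> \<bar>g x\<bar> \<le> B" using assms locally_bounded_def by metis
  then show ?thesis using that[of "max B 0"] by (metis max.coboundedI1 max.cobounded2)
qed

lemma continuous_locally_bounded:
  assumes "continuous_on UNIV g"
  shows "locally_bounded g"
  unfolding locally_bounded_def
proof
  fix r
  have "compact (g ` cball 0 r)"
    by (rule compact_continuous_image[OF continuous_on_subset[OF assms] compact_cball]) simp
  then obtain B where "\<forall>y\<in>g ` cball 0 r. norm y \<le> B"
    using compact_imp_bounded bounded_iff by metis
  then show "\<exists>B. \<forall>x. norm x \<le> r \<longrightarrow> \<bar>g x\<bar> \<le> B" by (auto intro!: exI[of _ B])
qed

lemma locally_bounded_mult:
  assumes "locally_bounded f" "locally_bounded g"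
  shows "locally_bounded (\<lambda>x. f x * g x)"
  unfolding locally_bounded_def
proof
  fix r
  obtain A where A: "0 \<le> A" "\<And>x. norm x \<le> r \<Longrightarrow> \<bar>f x\<bar> \<le> A" using locally_boundedD[OF assms(1)] by metis
  obtain B where B: "0 \<le> B" "\<And>x. norm x \<le> r \<Longrightarrow> \<bar>g x\<bar> \<le> B" using locally_boundedD[OF assms(2)] by metis
  have "\<bar>f x * g x\<bar> \<le> A * B" if "norm x \<le> r" for x
    unfolding abs_mult using A(1) A(2)[OF that] B(2)[OF that] by (intro mult_mono) auto
  then show "\<exists>C. \<forall>x. norm x \<le> r \<longrightarrow> \<bar>f x * g x\<bar> \<le> C" by blast
qed

lemma locally_bounded_add:
  assumes "locally_bounded f" "locally_bounded g"
  shows "locally_bounded (\<lambda>x. f x + g x)"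
  unfolding locally_bounded_def
proof
  fix r
  obtain A where A: "0 \<le> A" "\<And>x. norm x \<le> r \<Longrightarrow> \<bar>f x\<bar> \<le> A" using locally_boundedD[OF assms(1)] by metis
  obtain B where B: "0 \<le> B" "\<And>x. norm x \<le> r \<Longrightarrow> \<bar>g x\<bar> \<le> B" using locally_boundedD[OF assms(2)] by metis
  have "\<bar>f x + g x\<bar> \<le> A + B" if "norm x \<le> r" for x
    using A(2)[OF that] B(2)[OF that] by linarith
  then show "\<exists>C. \<forall>x. norm x \<le> r \<longrightarrow> \<bar>f x + g x\<bar> \<le> C" by blast
qed

lemma locally_bounded_translate:
  assumes "locally_bounded f"
  shows "locally_bounded (\<lambda>x. f (y - x))"
  unfolding locally_bounded_def
proof
  fix r
  obtain A where A: "0 \<le> A" "\<And>x. norm x \<le> norm y + r \<Longrightarrow> \<bar>f x\<bar> \<le> A" using locally_boundedD[OF assms(1)] by metis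
  have "\<bar>f (y - x)\<bar> \<le> A" if "norm x \<le> r" for x
    using norm_triangle_ineq4[of y x] that by (intro A) linarith
  then show "\<exists>C. \<forall>x. norm x \<le> r \<longrightarrow> \<bar>f (y - x)\<bar> \<le> C" by blast
qed

definition convolution :: "(real^2 \<Rightarrow> real) \<Rightarrow> (real^2 \<Rightarrow> real) \<Rightarrow> real^2 \<Rightarrow> real" where
  "convolution \<eta> f y = (\<integral>x. \<eta> (y - x) * f x \<partial>lborel)"

lemma lborel_integral_reflect:
  fixes F :: "real^2 \<Rightarrow> real"
  assumes [measurable]: "F \<in> borel_measurable borel"
  shows "(\<integral>x. F x \<partial>lborel) = (\<integral>x. F (y - x) \<partial>lborel)"
proof -
  have [measurable]: "(\<lambda>x. y - x) \<in> borel \<rightarrow>\<^sub>M (borel :: (real^2) measure)" by simp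
  have "(lborel :: (real^2) measure) = distr lborel borel (\<lambda>x. y - x)"
    using lborel_affine[of "-1" y] by (simp add: density_1)
  then have "(\<integral>x. F x \<partial>lborel) = (\<integral>x. F x \<partial>(distr lborel borel (\<lambda>x. y - x)))" by simp
  also have "\<dots> = (\<integral>x. F (y - x) \<partial>lborel)" by (rule integral_distr) auto
  finally show ?thesis .
qed

lemma convolution_reflect:
  assumes [measurable]: "\<eta> \<in> borel_measurable borel" "f \<in> borel_measurable borel"
  shows "convolution \<eta> f y = (\<integral>x. \<eta> x * f (y - x) \<partial>lborel)"
proof -
  have "convolution \<eta> f y = (\<integral>x. \<eta> (y - (y - x)) * f (y - x) \<partial>lborel)"
    unfolding convolution_def
    by (subst lborel_integral_reflect[of _ y]) (auto intro!: borel_measurable_times)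
  then show ?thesis by simp
qed

lemma integrable_vanishing:
  fixes F :: "real^2 \<Rightarrow> real"
  assumes [measurable]: "F \<in> borel_measurable borel" and "locally_bounded F"
    and van: "\<And>x. r < norm x \<Longrightarrow> F x = 0"
  shows "integrable lborel F"
proof -
  obtain B where B: "0 \<le> B" "\<And>x. norm x \<le> r \<Longrightarrow> \<bar>F x\<bar> \<le> B" using locally_boundedD[OF assms(2)] by metis
  show ?thesis
    by (rule integrableI_bounded_set[where A="cball 0 r" and B=B])
       (use B van emeasure_bounded_finite[OF bounded_cball] in auto)
qed

locale kernel =
  fixes \<eta> :: "real^2 \<Rightarrow> real" and \<rho> :: real
  assumes smooth: "\<And>j. Cj j \<eta>" and vanish: "\<And>x. \<rho> < norm x \<Longrightarrow> \<eta> x = 0"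
begin

lemma cont: "continuous_on UNIV \<eta>" using smooth[of 0] by simp

lemma meas [measurable]: "\<eta> \<in> borel_measurable borel"
  using cont by (rule borel_measurable_continuous_onI)

lemma kernel_partial: "kernel (partial i \<eta>) \<rho>"
proof
  fix j show "Cj j (partial i \<eta>)" using smooth[of "Suc j"] by simp
next
  fix x assume "\<rho> < norm (x :: real^2)"
  then show "partial i \<eta> x = 0" using vanish by (rule vanishing_partial[rotated])
qed

lemma integrable_kernel:
  assumes [measurable]: "f \<in> borel_measurable borel" and "locally_bounded f"
  shows "integrable lborel (\<lambda>x. \<eta> x * f (y - x))"
proof (rule integrable_vanishing[where r=\<rho>])
  show "locally_bounded (\<lambda>x. \<eta> x * f (y - x))"
    by (rule locally_bounded_mult[OF continuous_locally_bounded[OF cont]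
          locally_bounded_translate[OF assms(2)]])
qed (auto simp: vanish)

lemma integrable_kernel':
  assumes [measurable]: "f \<in> borel_measurable borel" and "locally_bounded f"
  shows "integrable lborel (\<lambda>x. \<eta> (y - x) * f x)"
proof (rule integrable_vanishing[where r="norm y + \<rho>"])
  fix x :: "real^2" assume "norm y + \<rho> < norm x"
  then have "\<rho> < norm (y - x)" using norm_triangle_ineq2[of x y] by (simp add: norm_minus_commute)
  then show "\<eta> (y - x) * f x = 0" by (simp add: vanish)
next
  show "locally_bounded (\<lambda>x. \<eta> (y - x) * f x)"
    by (rule locally_bounded_mult[OF locally_bounded_translate[OF continuous_locally_bounded[OF cont]]
          assms(2)])
qed auto

lemma continuous_convolution:
  assumes [measurable]: "f \<in> borel_measurable borel" and lb: "locally_bounded f"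
  shows "isCont (convolution \<eta> f) y"
proof (rule continuous_within_sequentiallyI)
  fix u :: "nat \<Rightarrow> real^2" assume u: "u \<longlonglongrightarrow> y"
  obtain K where K: "\<And>n. norm (u n) \<le> K"
    using Bseq_eq_bounded convergent_imp_Bseq[of u] u unfolding convergent_def Bseq_def by blast
  obtain B where B: "0 \<le> B" "\<And>x. norm x \<le> \<rho> \<Longrightarrow> \<bar>\<eta> x\<bar> \<le> B"
    using locally_boundedD[OF continuous_locally_bounded[OF cont]] by metis
  then have B: "\<bar>\<eta> x\<bar> \<le> B" "0 \<le> B" for x using vanish[of x] by (metis abs_zero not_le)+
  show "(\<lambda>n. convolution \<eta> f (u n)) \<longlonglongrightarrow> convolution \<eta> f y"
    unfolding convolution_def
  proof (rule integral_dominated_convergence[where w="\<lambda>x. B * (indicator (cball 0 (K + \<rho>)) x * \<bar>f x\<bar>)"])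
    show "integrable lborel (\<lambda>x. B * (indicator (cball 0 (K + \<rho>)) x * \<bar>f x\<bar>))"
    proof (intro integrable_mult_right integrable_vanishing[where r="K + \<rho>"])
      have "cball 0 (K + \<rho>) \<in> sets borel" by simp
      then show "(\<lambda>x. indicator (cball 0 (K + \<rho>)) x * \<bar>f x\<bar>) \<in> borel_measurable borel"
        by measurable
      show "locally_bounded (\<lambda>x. indicator (cball 0 (K + \<rho>)) x * \<bar>f x\<bar>)"
        by (intro locally_bounded_mult) (use lb in \<open>auto simp: locally_bounded_def indicator_def\<close>)
    qed auto
    show "AE x in lborel. (\<lambda>n. \<eta> (u n - x) * f x) \<longlonglongrightarrow> \<eta> (y - x) * f x"
    proof (rule AE_I2)
      fix x
      have "isCont \<eta> (y - x)" using cont by (simp add: continuous_on_eq_continuous_at)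
      then have "(\<lambda>n. \<eta> (u n - x)) \<longlonglongrightarrow> \<eta> (y - x)"
        by (rule isCont_tendsto_compose) (intro tendsto_intros u)
      then show "(\<lambda>n. \<eta> (u n - x) * f x) \<longlonglongrightarrow> \<eta> (y - x) * f x" by (intro tendsto_intros)
    qed
    fix n
    show "AE x in lborel. norm (\<eta> (u n - x) * f x) \<le> B * (indicator (cball 0 (K + \<rho>)) x * \<bar>f x\<bar>)"
    proof (rule AE_I2)
      fix x
      show "norm (\<eta> (u n - x) * f x) \<le> B * (indicator (cball 0 (K + \<rho>)) x * \<bar>f x\<bar>)"
      proof (cases "norm x \<le> K + \<rho>")
        case True
        then show ?thesis using B by (auto simp: abs_mult intro!: mult_right_mono)
      next
        case False
        then have "\<rho> < norm (u n - x)"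
          using norm_triangle_ineq2[of x "u n"] K[of n] by (simp add: norm_minus_commute)
        then show ?thesis using B by (simp add: vanish)
      qed
    qed
  qed auto
qed

text \<open>Near \<open>y\<close> the integral may be taken over a fixed box, since the kernel has bounded support.
  There differentiation under the integral sign applies.\<close>

lemma has_derivative_convolution:
  assumes f: "continuous_on UNIV f"
  shows "(convolution \<eta> f has_derivative (\<lambda>v. \<Sum>i\<in>UNIV. v $ i * convolution (partial i \<eta>) f y)) (at y)"
proof -
  define K where "K = norm y + 1 + \<bar>\<rho>\<bar>"
  obtain a b :: "real^2" where ab: "cball 0 K \<subseteq> cbox a b"
    using bounded_subset_cbox_symmetric[OF bounded_cball] by blast
  have meas_f [measurable]: "f \<in> borel_measurable borel" using f by (rule borel_measurable_continuous_onI)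
  have lb: "locally_bounded f" using f by (rule continuous_locally_bounded)
  have box: "convolution \<theta> f u = integral (cbox a b) (\<lambda>x. \<theta> (u - x) * f x)"
    if k: "kernel \<theta> \<rho>" and u: "u \<in> ball y 1" for \<theta> u
  proof -
    interpret k: kernel \<theta> \<rho> by (rule k)
    have "\<theta> (u - x) * f x = indicator (cbox a b) x *\<^sub>R (\<theta> (u - x) * f x)" for x
    proof (cases "norm x \<le> K")
      case True
      then show ?thesis using ab by (auto simp: indicator_def subset_eq)
    next
      case False
      have "norm u < norm y + 1" using u norm_triangle_ineq2[of u y]
        by (simp add: dist_norm norm_minus_commute)
      then have "\<rho> < norm (u - x)"
        using norm_triangle_ineq2[of x u] False by (simp add: norm_minus_commute K_def)
      then show ?thesis by (simp add: k.vanish)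
    qed
    then have "convolution \<theta> f u = (LINT x:cbox a b|lborel. \<theta> (u - x) * f x)"
      unfolding convolution_def set_lebesgue_integral_def by (intro Bochner_Integration.integral_cong) auto
    also have "\<dots> = integral (cbox a b) (\<lambda>x. \<theta> (u - x) * f x)"
    proof (rule set_borel_integral_eq_integral)
      show "set_integrable lborel (cbox a b) (\<lambda>x. \<theta> (u - x) * f x)"
        unfolding set_integrable_def by (intro integrable_mult_indicator k.integrable_kernel' lb) auto
    qed
    finally show ?thesis .
  qed
  \<comment> \<open>the derivative of the integrand, as a bounded linear function\<close>
  define D where "D u x = (\<Sum>i\<in>UNIV. (partial i \<eta> (u - x) * f x) *\<^sub>R Blinfun (\<lambda>v::real^2. v $ i))" for u x
  have Dapp: "blinfun_apply (D u x) v = (\<Sum>i\<in>UNIV. v $ i * (partial i \<eta> (u - x) * f x))" for u x v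
    by (simp add: D_def blinfun.sum_left blinfun.scaleR_left bounded_linear_Blinfun_apply
        bounded_linear_vec_nth mult.commute)
  have cp: "continuous_on UNIV (partial i \<eta>)" for i
    using smooth[of 1] by auto
  have cont_D: "continuous_on (ball y 1 \<times> cbox a b) (\<lambda>(u, x). D u x)"
    unfolding D_def split_beta
    by (intro continuous_intros continuous_on_compose2[OF cp] continuous_on_compose2[OF f]) auto
  have "((\<lambda>u. integral (cbox a b) (\<lambda>x. \<eta> (u - x) * f x)) has_derivative
      blinfun_apply (integral (cbox a b) (D y))) (at y within ball y 1)"
  proof (rule leibniz_rule[OF _ _ cont_D])
    fix u x assume "u \<in> ball y 1" "x \<in> cbox a b"
    have "\<eta> differentiable (at (u - x))" using smooth[of 1] by auto
    from has_derivative_partials[OF this]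
    have "((\<lambda>u. \<eta> (u - x)) has_derivative (\<lambda>v. \<Sum>i\<in>UNIV. (v $ i) *\<^sub>R partial i \<eta> (u - x))) (at u)"
      by (rule has_derivative_compose[of "\<lambda>u. u - x" "\<lambda>v. v", rotated]) (auto intro!: derivative_eq_intros)
    from has_derivative_mult_left[OF this, of "f x"]
    have "((\<lambda>u. \<eta> (u - x) * f x) has_derivative blinfun_apply (D u x)) (at u)"
      by (rule has_derivative_eq_rhs) (simp add: fun_eq_iff Dapp sum_distrib_right sum_distrib_left mult_ac)
    then show "((\<lambda>u. \<eta> (u - x) * f x) has_derivative blinfun_apply (D u x)) (at u within ball y 1)"
      by (rule has_derivative_at_withinI)
  next
    fix u show "(\<lambda>x. \<eta> (u - x) * f x) integrable_on cbox a b"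
      by (intro integrable_continuous continuous_intros continuous_on_compose2[OF cont] continuous_on_compose2[OF f]) auto
  qed auto
  then have "((\<lambda>u. integral (cbox a b) (\<lambda>x. \<eta> (u - x) * f x)) has_derivative
      blinfun_apply (integral (cbox a b) (D y))) (at y)"
    by (simp add: at_within_open[of y "ball y 1"])
  note deriv = this
  have app: "blinfun_apply (integral (cbox a b) (D y)) v = (\<Sum>i\<in>UNIV. v $ i * convolution (partial i \<eta>) f y)" for v
  proof -
    have intp: "(\<lambda>x. partial i \<eta> (y - x) * f x) integrable_on cbox a b" for i
      by (intro integrable_continuous continuous_intros continuous_on_compose2[OF cp] continuous_on_compose2[OF f]) auto
    have "D y integrable_on cbox a b"
      by (intro integrable_continuous continuous_on_compose2[OF cont_D, of _ "\<lambda>x. (y, x)", simplified] continuous_intros) auto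
    then have "blinfun_apply (integral (cbox a b) (D y)) v = integral (cbox a b) (\<lambda>x. \<Sum>i\<in>UNIV. v $ i * (partial i \<eta> (y - x) * f x))"
      by (simp add: blinfun_apply_integral Dapp)
    also have "\<dots> = (\<Sum>i\<in>UNIV. v $ i * integral (cbox a b) (\<lambda>x. partial i \<eta> (y - x) * f x))"
      using integrable_cmul[OF intp] by (subst integral_sum) auto
    finally show ?thesis using box[OF kernel_partial] by simp
  qed
  from deriv have "((\<lambda>u. integral (cbox a b) (\<lambda>x. \<eta> (u - x) * f x)) has_derivative
      (\<lambda>v. \<Sum>i\<in>UNIV. v $ i * convolution (partial i \<eta>) f y)) (at y)"
    by (rule has_derivative_eq_rhs) (simp add: fun_eq_iff app)
  then show ?thesis
    by (rule has_derivative_transform_within_open[where s="ball y 1"]) (use box[OF kernel_axioms] in auto)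
qed

lemma partial_convolution:
  assumes "continuous_on UNIV f"
  shows "partial i (convolution \<eta> f) = convolution (partial i \<eta>) f"
proof
  fix y show "partial i (convolution \<eta> f) y = convolution (partial i \<eta>) f y"
    using partial_eqI[OF has_derivative_convolution[OF assms], of i y]
    by (simp add: axis_def if_distribR if_distrib[of "\<lambda>x. x * _"] cong: if_cong)
qed

end

lemma Cj_convolution:
  assumes "kernel \<eta> \<rho>" "continuous_on UNIV f"
  shows "Cj j (convolution \<eta> f)"
  using assms(1)
proof (induction j arbitrary: \<eta>)
  case 0
  then interpret kernel \<eta> \<rho> .
  show ?case
    using has_derivative_continuous[OF has_derivative_convolution[OF assms(2)]]
    by (simp add: continuous_at_imp_continuous_on)
next
  case (Suc j)
  then interpret kernel \<eta> \<rho> by simp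
  show ?case
    using has_derivative_convolution[OF assms(2)] Suc.IH[OF kernel_partial]
    by (auto simp: partial_convolution[OF assms(2)] differentiable_def)
qed

section \<open>Derivatives of convolutions from increments\<close>

text \<open>The mean of \<open>g\<close> over the segment from \<open>x\<close> to \<open>x + z\<close>. Increments of functions are always
  estimated by such means, since they still make sense when \<open>g\<close> is only Borel, where \<open>g\<close> could not
  bound a derivative pointwise.\<close>

definition segment_mean :: "(real^2 \<Rightarrow> real) \<Rightarrow> real^2 \<Rightarrow> real^2 \<Rightarrow> real" where
  "segment_mean g x z = (\<integral>s. indicator {0..1} s * g (x + s *\<^sub>R z) \<partial>lborel)"

lemma integrable_unit_interval:
  fixes k :: "real \<Rightarrow> real"
  assumes [measurable]: "k \<in> borel_measurable borel" and B: "\<And>s. s \<in> {0..1} \<Longrightarrow> \<bar>k s\<bar> \<le> B"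
  shows "integrable lborel (\<lambda>s. indicator {0..1} s * k s)"
  by (rule integrableI_bounded_set[where A="{0..1}" and B=B])
     (auto simp: B)

lemma unit_interval_mean_le:
  fixes k :: "real \<Rightarrow> real"
  assumes "integrable lborel (\<lambda>s. indicator {0..1} s * k s)" "\<And>s. s \<in> {0..1} \<Longrightarrow> k s \<le> c"
  shows "(\<integral>s. indicator {0..1} s * k s \<partial>lborel) \<le> c"
proof -
  have "(\<integral>s. indicator {0..1} s * k s \<partial>lborel) \<le> (\<integral>s. indicator {0..1::real} s * c \<partial>lborel)"
  proof (rule integral_mono[OF assms(1)])
    show "integrable lborel (\<lambda>s. indicator {0..1::real} s * c)" by simp
  qed (use assms(2) in \<open>auto simp: indicator_def\<close>)
  then show ?thesis by simp
qed

lemma integrable_segment: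
  assumes [measurable]: "g \<in> borel_measurable borel" and lb: "locally_bounded g"
  shows "integrable lborel (\<lambda>s. indicator {0..1} s * g (x + s *\<^sub>R z))"
proof -
  obtain B where B: "\<And>u. norm u \<le> norm x + norm z \<Longrightarrow> \<bar>g u\<bar> \<le> B"
    using locally_boundedD[OF lb] by metis
  have "norm (x + s *\<^sub>R z) \<le> norm x + norm z" if "s \<in> {0..1}" for s
  proof -
    have "norm (x + s *\<^sub>R z) \<le> norm x + \<bar>s\<bar> * norm z" using norm_triangle_ineq[of x "s *\<^sub>R z"] by simp
    also have "\<bar>s\<bar> * norm z \<le> 1 * norm z" using that by (intro mult_right_mono) auto
    finally show ?thesis by simp
  qed
  then show ?thesis using B by (intro integrable_unit_interval[where B=B]) auto
qed

lemma segment_mean_le: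
  assumes "g \<in> borel_measurable borel" "locally_bounded g"
    and "\<And>s. s \<in> {0..1} \<Longrightarrow> g (x + s *\<^sub>R z) \<le> c"
  shows "segment_mean g x z \<le> c"
  unfolding segment_mean_def by (intro unit_interval_mean_le integrable_segment assms)

text \<open>Convolution commutes with averaging along a direction, by Fubini's theorem.\<close>

lemma (in kernel) convolution_segment_mean:
  assumes [measurable]: "g \<in> borel_measurable borel" and lb: "locally_bounded g"
  shows "integrable lborel (\<lambda>x. \<eta> x * segment_mean g (y - x) z)"
    and "(\<integral>x. \<eta> x * segment_mean g (y - x) z \<partial>lborel) = segment_mean (convolution \<eta> g) y z"
proof -
  let ?F = "\<lambda>x s. \<eta> x * (indicator {0..1} s * g (y - x + s *\<^sub>R z))"
  obtain M where M: "0 \<le> M" "\<And>x. norm x \<le> \<rho> \<Longrightarrow> \<bar>\<eta> x\<bar> \<le> M"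
    using locally_boundedD[OF continuous_locally_bounded[OF cont]] by metis
  obtain B where B: "0 \<le> B" "\<And>u. norm u \<le> norm y + \<rho> + norm z \<Longrightarrow> \<bar>g u\<bar> \<le> B"
    using locally_boundedD[OF lb] by metis
  have int: "integrable (lborel \<Otimes>\<^sub>M lborel) (case_prod ?F)"
  proof (rule integrableI_bounded_set[where A="cball 0 \<rho> \<times> {0..1}" and B="M * B"])
    show "emeasure (lborel \<Otimes>\<^sub>M lborel) (cball (0::real^2) \<rho> \<times> {0..1::real}) < \<infinity>"
      using emeasure_bounded_finite[OF bounded_cball, of "0::real^2" \<rho>]
      by (subst lborel.emeasure_pair_measure_Times) (auto simp: ennreal_mult_less_top)
    show "AE w in lborel \<Otimes>\<^sub>M lborel. w \<in> cball (0::real^2) \<rho> \<times> {0..1::real} \<longrightarrow> norm (case_prod ?F w) \<le> M * B"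
    proof (intro AE_I2 impI)
      fix w assume w: "w \<in> cball (0::real^2) \<rho> \<times> {0..1::real}"
      obtain x s where xs: "w = (x, s)" by (cases w)
      have x: "norm x \<le> \<rho>" and s: "0 \<le> s" "s \<le> 1" using w xs by auto
      have "norm (y - x + s *\<^sub>R z) \<le> norm y + norm x + \<bar>s\<bar> * norm z"
        using norm_triangle_ineq[of "y - x" "s *\<^sub>R z"] norm_triangle_ineq4[of y x] by simp
      also have "\<bar>s\<bar> * norm z \<le> 1 * norm z" using s by (intro mult_right_mono) auto
      finally have "\<bar>g (y - x + s *\<^sub>R z)\<bar> \<le> B" using x by (intro B(2)) simp
      then show "norm (case_prod ?F w) \<le> M * B"
        using M(1) M(2)[OF x] s xs by (auto simp: abs_mult intro!: mult_mono)
    qed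
    show "AE w in lborel \<Otimes>\<^sub>M lborel. w \<notin> cball (0::real^2) \<rho> \<times> {0..1::real} \<longrightarrow> case_prod ?F w = 0"
      by (intro AE_I2) (auto simp: indicator_def not_less[symmetric] dest: vanish)
  qed auto
  show "integrable lborel (\<lambda>x. \<eta> x * segment_mean g (y - x) z)"
    using lborel_pair.integrable_fst[OF int] by (simp add: segment_mean_def)
  have "(\<integral>x. \<eta> x * segment_mean g (y - x) z \<partial>lborel) = (\<integral>x. (\<integral>s. ?F x s \<partial>lborel) \<partial>lborel)"
    by (simp add: segment_mean_def)
  also have "\<dots> = (\<integral>s. (\<integral>x. ?F x s \<partial>lborel) \<partial>lborel)"
    using lborel_pair.Fubini_integral[OF int] by simp
  also have "\<dots> = segment_mean (convolution \<eta> g) y z"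
    unfolding segment_mean_def
  proof (intro Bochner_Integration.integral_cong refl)
    fix s :: real
    have "(\<integral>x. ?F x s \<partial>lborel) = (\<integral>x. indicator {0..1} s * (\<eta> x * g (y + s *\<^sub>R z - x)) \<partial>lborel)"
      by (intro Bochner_Integration.integral_cong refl) (simp add: algebra_simps)
    then show "(\<integral>x. ?F x s \<partial>lborel) = indicator {0..1} s * convolution \<eta> g (y + s *\<^sub>R z)"
      by (simp add: convolution_reflect)
  qed
  finally show "(\<integral>x. \<eta> x * segment_mean g (y - x) z \<partial>lborel) = segment_mean (convolution \<eta> g) y z" .
qed

text \<open>An estimate for the increments of \<open>f\<close> in direction \<open>z\<close> becomes, after convolution, a bound
  on the directional derivative at every point, although \<open>g\<close> may be discontinuous: the difference
  quotient of the convolution is at most the mean of the convolution of \<open>g\<close> over a short segment,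
  and the latter is continuous.\<close>

lemma (in kernel) derivative_convolution_le:
  assumes pos: "\<And>x. 0 \<le> \<eta> x" and f: "continuous_on UNIV f"
    and g [measurable]: "g \<in> borel_measurable borel" and lb: "locally_bounded g"
    and step: "\<And>x t. 0 < t \<Longrightarrow> f (x + t *\<^sub>R z) - f x \<le> t * segment_mean g x (t *\<^sub>R z)"
  shows "(\<Sum>i\<in>UNIV. z $ i * partial i (convolution \<eta> f) y) \<le> convolution \<eta> g y"
proof -
  have [measurable]: "f \<in> borel_measurable borel" using f by (rule borel_measurable_continuous_onI)
  have lbf: "locally_bounded f" using f by (rule continuous_locally_bounded)
  define D where "D = (\<Sum>i\<in>UNIV. z $ i * partial i (convolution \<eta> f) y)"
  have "((\<lambda>t. y + t *\<^sub>R z) has_derivative (\<lambda>t. t *\<^sub>R z)) (at 0)" by (auto intro!: derivative_eq_intros)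
  from has_derivative_compose[OF this has_derivative_convolution[OF f]]
  have "((\<lambda>t. convolution \<eta> f (y + t *\<^sub>R z)) has_derivative
      (\<lambda>t. \<Sum>i\<in>UNIV. (t *\<^sub>R z) $ i * convolution (partial i \<eta>) f y)) (at 0)" by simp
  then have "((\<lambda>t. convolution \<eta> f (y + t *\<^sub>R z)) has_real_derivative D) (at 0)"
    unfolding has_field_derivative_def
    by (rule has_derivative_eq_rhs) (auto simp: D_def partial_convolution[OF f] fun_eq_iff sum_2 algebra_simps)
  then have lim: "((\<lambda>t. (convolution \<eta> f (y + t *\<^sub>R z) - convolution \<eta> f y) / t) \<longlongrightarrow> D) (at_right 0)"
    by (simp add: DERIV_def filterlim_at_split)
  have "D \<le> convolution \<eta> g y + e" if e: "0 < e" for e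
  proof (rule tendsto_upperbound[OF lim])
    obtain d where d: "d > 0" "\<And>u. dist u y < d \<Longrightarrow> dist (convolution \<eta> g u) (convolution \<eta> g y) < e"
      using continuous_convolution[OF g lb] e unfolding continuous_at_eps_delta by blast
    have "(convolution \<eta> f (y + t *\<^sub>R z) - convolution \<eta> f y) / t \<le> convolution \<eta> g y + e"
      if t: "0 < t" "t * norm z < d" for t
    proof -
      have "convolution \<eta> f (y + t *\<^sub>R z) - convolution \<eta> f y
          = (\<integral>x. \<eta> x * f (y + t *\<^sub>R z - x) - \<eta> x * f (y - x) \<partial>lborel)"
        by (simp add: convolution_reflect integrable_kernel lbf)
      also have "\<dots> \<le> (\<integral>x. t * (\<eta> x * segment_mean g (y - x) (t *\<^sub>R z)) \<partial>lborel)"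
      proof (rule integral_mono)
        show "integrable lborel (\<lambda>x. \<eta> x * f (y + t *\<^sub>R z - x) - \<eta> x * f (y - x))"
          by (intro Bochner_Integration.integrable_diff integrable_kernel lbf) auto
        show "integrable lborel (\<lambda>x. t * (\<eta> x * segment_mean g (y - x) (t *\<^sub>R z)))"
          by (intro integrable_mult_right convolution_segment_mean lb g)
        fix x
        have "\<eta> x * (f (y - x + t *\<^sub>R z) - f (y - x)) \<le> \<eta> x * (t * segment_mean g (y - x) (t *\<^sub>R z))"
          by (intro mult_left_mono step pos t)
        then show "\<eta> x * f (y + t *\<^sub>R z - x) - \<eta> x * f (y - x) \<le> t * (\<eta> x * segment_mean g (y - x) (t *\<^sub>R z))"
          by (simp add: algebra_simps)
      qed
      also have "\<dots> = t * segment_mean (convolution \<eta> g) y (t *\<^sub>R z)"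
        using convolution_segment_mean[OF g lb] by simp
      also have "segment_mean (convolution \<eta> g) y (t *\<^sub>R z) \<le> convolution \<eta> g y + e"
      proof -
        have c: "continuous_on UNIV (convolution \<eta> g)"
          using continuous_convolution[OF g lb] by (simp add: continuous_at_imp_continuous_on)
        show ?thesis
        proof (rule segment_mean_le)
          fix s :: real assume s: "s \<in> {0..1}"
          have "dist (y + s *\<^sub>R t *\<^sub>R z) y = s * (t * norm z)" using s t by (simp add: dist_norm)
          also have "\<dots> \<le> 1 * (t * norm z)" using s t by (intro mult_right_mono) auto
          finally have "dist (y + s *\<^sub>R t *\<^sub>R z) y < d" using t by simp
          from d(2)[OF this] show "convolution \<eta> g (y + s *\<^sub>R t *\<^sub>R z) \<le> convolution \<eta> g y + e"
            by (simp add: dist_real_def)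
        qed (use c borel_measurable_continuous_onI continuous_locally_bounded in auto)
      qed
      finally show ?thesis using t by (simp add: field_simps)
    qed
    moreover have "eventually (\<lambda>t. 0 < t \<and> t * norm z < d) (at_right 0)"
    proof -
      have "((\<lambda>t. t * norm z) \<longlongrightarrow> 0 * norm z) (at_right 0)" by (intro tendsto_intros)
      then have "eventually (\<lambda>t. t * norm z < d) (at_right 0)" using d(1) order_tendstoD(2) by fastforce
      then show ?thesis using eventually_at_right_less[of 0] by eventually_elim auto
    qed
    ultimately show "\<forall>\<^sub>F t in at_right 0. (convolution \<eta> f (y + t *\<^sub>R z) - convolution \<eta> f y) / t \<le> convolution \<eta> g y + e"
      by (auto elim: eventually_mono)
  qed simp
  then have "D \<le> convolution \<eta> g y" by (rule field_le_epsilon)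
  then show ?thesis by (simp add: D_def)
qed

text \<open>For a \<open>C\<^sup>1\<close> function the fundamental theorem of calculus gives the increment estimate with
  equality.\<close>

lemma segment_mean_derivative:
  fixes f :: "real^2 \<Rightarrow> real"
  assumes f: "Cj 1 f"
  shows "segment_mean (\<lambda>x. \<Sum>i\<in>UNIV. z $ i * partial i f x) x (t *\<^sub>R z) * t = f (x + t *\<^sub>R z) - f x"
proof -
  have d: "((\<lambda>s. f (x + s *\<^sub>R t *\<^sub>R z)) has_real_derivative
      t * (\<Sum>i\<in>UNIV. z $ i * partial i f (x + s *\<^sub>R t *\<^sub>R z))) (at s)" for s
  proof -
    have 1: "((\<lambda>s. x + s *\<^sub>R t *\<^sub>R z) has_derivative (\<lambda>s. s *\<^sub>R t *\<^sub>R z)) (at s)"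
      by (auto intro!: derivative_eq_intros)
    have 2: "f differentiable (at (x + s *\<^sub>R t *\<^sub>R z))" using f by simp
    from has_derivative_compose[OF 1 has_derivative_partials[OF 2]] show ?thesis
      unfolding has_field_derivative_def
      by (rule has_derivative_eq_rhs) (simp add: fun_eq_iff sum_2 algebra_simps)
  qed
  have cp: "continuous_on UNIV (partial i f)" for i using f by simp
  have "(\<integral>s. indicator {0..1} s *\<^sub>R (t * (\<Sum>i\<in>UNIV. z $ i * partial i f (x + s *\<^sub>R t *\<^sub>R z))) \<partial>lborel)
      = f (x + 1 *\<^sub>R t *\<^sub>R z) - f (x + 0 *\<^sub>R t *\<^sub>R z)"
  proof (rule integral_FTC_Icc)
    fix s show "((\<lambda>s. f (x + s *\<^sub>R t *\<^sub>R z)) has_vector_derivative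
        t * (\<Sum>i\<in>UNIV. z $ i * partial i f (x + s *\<^sub>R t *\<^sub>R z))) (at s within {0..1})"
      using d by (auto simp: has_real_derivative_iff_has_vector_derivative[symmetric] intro: has_field_derivative_at_within)
    show "continuous_on {0..1} (\<lambda>s. t * (\<Sum>i\<in>UNIV. z $ i * partial i f (x + s *\<^sub>R t *\<^sub>R z)))"
      by (intro continuous_intros continuous_on_compose2[OF cp]) auto
  qed simp
  then show ?thesis by (simp add: segment_mean_def mult_ac)
qed

section \<open>Mollifiers and cutoff functions\<close>

text \<open>The kernel vanishes outside the ball of radius \<open>\<rho>\<close>, so bounds on \<open>f\<close> near \<open>y\<close> pass to the
  convolution at \<open>y\<close>.\<close>

locale mollifier = kernel +
  assumes nonneg: "\<And>x. 0 \<le> \<eta> x" and mass: "(\<integral>x. \<eta> x \<partial>lborel) = 1"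
begin

lemma convolution_le:
  assumes [measurable]: "f \<in> borel_measurable borel" and lb: "locally_bounded f"
    and c: "\<And>x. dist x y \<le> \<rho> \<Longrightarrow> f x \<le> c"
  shows "convolution \<eta> f y \<le> c"
proof -
  have int: "integrable lborel \<eta>"
    using integrable_kernel[of "\<lambda>_. 1" 0] by (simp add: locally_bounded_def exI[of _ 1])
  have "convolution \<eta> f y \<le> (\<integral>x. \<eta> x * c \<partial>lborel)"
    unfolding convolution_reflect[OF meas assms(1)]
  proof (rule integral_mono[OF integrable_kernel[OF assms(1) lb]])
    show "integrable lborel (\<lambda>x. \<eta> x * c)" using int by simp
    fix x
    show "\<eta> x * f (y - x) \<le> \<eta> x * c"
    proof (cases "norm x \<le> \<rho>")
      case True
      then show ?thesis by (intro mult_left_mono c nonneg) (simp add: dist_norm)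
    qed (simp add: vanish)
  qed
  then show ?thesis by (simp add: mass)
qed

lemma convolution_ge:
  assumes [measurable]: "f \<in> borel_measurable borel" and lb: "locally_bounded f"
    and c: "\<And>x. dist x y \<le> \<rho> \<Longrightarrow> c \<le> f x"
  shows "c \<le> convolution \<eta> f y"
proof -
  have "convolution \<eta> (\<lambda>x. - f x) y \<le> - c"
  proof (rule convolution_le)
    show "locally_bounded (\<lambda>x. - f x)" using lb by (simp add: locally_bounded_def)
  qed (use c in auto)
  then show ?thesis by (simp add: convolution_def)
qed

end

lemma mollifier_exists:
  assumes "0 < \<epsilon>"
  shows "\<exists>\<eta>. mollifier \<eta> \<epsilon>"
proof -
  define \<phi> where "\<phi> x = flat 0 (\<epsilon>\<^sup>2 - x \<bullet> x)" for x :: "real^2"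
  have sq: "x \<bullet> x = (norm x)\<^sup>2" for x :: "real^2" by (simp add: power2_norm_eq_inner)
  have kernel: "kernel \<phi> \<epsilon>"
  proof
    show "Cj j \<phi>" for j unfolding \<phi>_def by (rule Cj_flat)
    fix x :: "real^2" assume "\<epsilon> < norm x"
    then have "\<epsilon>\<^sup>2 \<le> (norm x)\<^sup>2" using assms by (intro power_mono) auto
    then show "\<phi> x = 0" by (simp add: \<phi>_def flat_def sq)
  qed
  then interpret kernel \<phi> \<epsilon> .
  have int: "integrable lborel \<phi>"
    using integrable_kernel[of "\<lambda>_. 1" 0] by (simp add: locally_bounded_def exI[of _ 1])
  have pos: "0 \<le> \<phi> x" for x by (simp add: \<phi>_def flat_def)
  have "(\<integral>x. \<phi> x \<partial>lborel) \<noteq> 0"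
  proof
    assume "(\<integral>x. \<phi> x \<partial>lborel) = 0"
    then have "AE x in lborel. \<phi> x = 0"
      using integral_nonneg_eq_0_iff_AE[OF int] pos by simp
    then have "AE x in lebesgue. \<phi> x = 0" by (rule AE_completion)
    then have "negligible {x. \<phi> x \<noteq> 0}"
      by (simp add: negligible_iff_null_sets AE_iff_null_sets eventually_ae_filter)
    moreover have "ball 0 \<epsilon> \<subseteq> {x. \<phi> x \<noteq> 0}"
    proof
      fix x :: "real^2" assume "x \<in> ball 0 \<epsilon>"
      then have "(norm x)\<^sup>2 < \<epsilon>\<^sup>2" by (intro power_strict_mono) auto
      then show "x \<in> {x. \<phi> x \<noteq> 0}" by (simp add: \<phi>_def flat_def sq)
    qed
    ultimately have "negligible (ball (0::real^2) \<epsilon>)" by (rule negligible_subset)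
    then show False using open_not_negligible[of "ball (0::real^2) \<epsilon>"] assms by simp
  qed
  then have I: "(\<integral>x. \<phi> x \<partial>lborel) \<noteq> 0" "0 \<le> (\<integral>x. \<phi> x \<partial>lborel)"
    using pos by (auto intro!: integral_nonneg)
  have "mollifier (\<lambda>x. inverse (\<integral>x. \<phi> x \<partial>lborel) *\<^sub>R \<phi> x) \<epsilon>"
  proof
    show "Cj j (\<lambda>x. inverse (\<integral>x. \<phi> x \<partial>lborel) *\<^sub>R \<phi> x)" for j by (intro Cj_scaleR Cj_const smooth)
  qed (use I pos vanish in auto)
  then show ?thesis by blast
qed

text \<open>Mollifying the piecewise linear function \<open>max 0 (min 1 (3 - \<bar>x\<bar>))\<close> at scale \<open>1\<close> keeps it
  equal to \<open>1\<close> on the unit ball and equal to \<open>0\<close> outside the ball of radius \<open>4\<close>.\<close>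

lemma smooth_cutoff_exists:
  obtains \<kappa> :: "real^2 \<Rightarrow> real" where "\<And>j. Cj j \<kappa>" "\<And>x. \<kappa> x \<in> {0..1}"
    "\<And>x. norm x \<le> 1 \<Longrightarrow> \<kappa> x = 1" "\<And>x. 4 < norm x \<Longrightarrow> \<kappa> x = 0"
proof -
  obtain \<eta> where "mollifier \<eta> 1" using mollifier_exists[of 1] by auto
  then interpret mollifier \<eta> 1 .
  define f where "f x = max 0 (min 1 (3 - norm x))" for x :: "real^2"
  have cont: "continuous_on UNIV f" unfolding f_def by (intro continuous_intros)
  then have m: "f \<in> borel_measurable borel" and lb: "locally_bounded f"
    by (auto intro: borel_measurable_continuous_onI continuous_locally_bounded)
  have tri: "norm x \<le> norm y + 1" "norm y \<le> norm x + 1" if "dist x y \<le> 1" for x y :: "real^2"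
    using norm_triangle_ineq2[of x y] norm_triangle_ineq2[of y x] that
    by (simp_all add: dist_norm norm_minus_commute)
  show ?thesis
  proof (rule that[of "convolution \<eta> f"])
    show "Cj j (convolution \<eta> f)" for j by (rule Cj_convolution[OF kernel_axioms cont])
    show "convolution \<eta> f x \<in> {0..1}" for x
      using convolution_le[OF m lb, of x 1] convolution_ge[OF m lb, of x 0] by (simp add: f_def)
    fix x :: "real^2"
    {
      assume x: "norm x \<le> 1"
      have "f u = 1" if "dist u x \<le> 1" for u using tri(1)[OF that] x by (simp add: f_def)
      then show "convolution \<eta> f x = 1"
        using convolution_le[OF m lb, of x 1] convolution_ge[OF m lb, of x 1] by force
    }
    {
      assume x: "4 < norm x"
      have "f u = 0" if "dist u x \<le> 1" for u using tri(2)[OF that] x by (simp add: f_def)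
      then show "convolution \<eta> f x = 0"
        using convolution_le[OF m lb, of x 0] convolution_ge[OF m lb, of x 0] by force
    }
  qed
qed

section \<open>Minimal action of curves\<close>

text \<open>\<open>c\<close> is the action of some Lipschitz curve from \<open>a\<close> to \<open>x\<close> that is differentiable except at
  finitely many times. This subclass of all Lipschitz curves contains the segments and is closed
  under concatenation, and an infimum over fewer curves is still bounded below by the infimum over
  all of them. The velocity is a separate function \<open>\<gamma>'\<close>, so that its values at the exceptional
  times can be chosen.\<close>

definition reaches ::
  "(real^2 \<Rightarrow> real^2 \<Rightarrow> real) \<Rightarrow> real^2 \<Rightarrow> real^2 \<Rightarrow> real \<Rightarrow> bool" where
  "reaches Lag a x c \<longleftrightarrow> (\<exists>\<gamma> \<gamma>' S B L. finite S \<and> L-lipschitz_on {0..1} \<gamma> \<and> \<gamma> 0 = a \<and> \<gamma> 1 = x \<and>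
     (\<forall>t\<in>{0<..<1} - S. (\<gamma> has_vector_derivative \<gamma>' t) (at t)) \<and>
     (\<forall>t\<in>{0..1}. \<bar>Lag (\<gamma> t) (\<gamma>' t)\<bar> \<le> B) \<and>
     ((\<lambda>t. Lag (\<gamma> t) (\<gamma>' t)) has_integral c) {0..1})"

text \<open>Positive homogeneity makes the action independent of the parametrization, which allows
  concatenation on the fixed interval \<open>[0,1]\<close>.\<close>

locale lagrangian =
  fixes Lag :: "real^2 \<Rightarrow> real^2 \<Rightarrow> real"
  assumes Lag_meas [measurable]: "\<And>z. (\<lambda>x. Lag x z) \<in> borel_measurable borel"
    and Lag_lb: "\<And>z. locally_bounded (\<lambda>x. Lag x z)"
    and Lag_scale: "\<And>x z t. 0 \<le> t \<Longrightarrow> Lag x (t *\<^sub>R z) = t * Lag x z"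
begin

definition cost :: "real^2 \<Rightarrow> real^2 \<Rightarrow> real" where
  "cost x z = segment_mean (\<lambda>u. Lag u z) x z"

lemma cost_has_integral: "((\<lambda>s. Lag (x + s *\<^sub>R z) z) has_integral cost x z) {0..1}"
proof -
  have "((\<lambda>s. indicator {0..1} s * Lag (x + s *\<^sub>R z) z) has_integral cost x z) UNIV"
    unfolding cost_def segment_mean_def
    by (rule has_integral_integral_lborel) (rule integrable_segment[OF Lag_meas Lag_lb])
  then have "((\<lambda>s. if s \<in> {0..1} then Lag (x + s *\<^sub>R z) z else 0) has_integral cost x z) UNIV"
    by (rule has_integral_eq[rotated]) (auto simp: indicator_def)
  then show ?thesis by (simp only: has_integral_restrict_UNIV)
qed

lemma reaches_start: "reaches Lag a a 0"
proof -
  have "Lag a 0 = 0" using Lag_scale[of 0 a 0] by simp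
  then show ?thesis unfolding reaches_def
    by (intro exI[of _ "\<lambda>_. a"] exI[of _ "\<lambda>_. 0"] exI[of _ "{}"] exI[of _ 0])
       (auto simp: lipschitz_on_def)
qed

text \<open>Run through the given curve at double speed on \<open>[0,1/2]\<close> and then through the segment from
  \<open>x\<close> to \<open>x + z\<close> on \<open>[1/2,1]\<close>.\<close>

lemma reaches_step:
  assumes "reaches Lag a x c"
  shows "reaches Lag a (x + z) (c + cost x z)"
proof -
  obtain \<gamma> \<gamma>' S B L where \<gamma>: "finite S" "L-lipschitz_on {0..1} \<gamma>" "\<gamma> 0 = a" "\<gamma> 1 = x"
    "\<And>t. t\<in>{0<..<1} - S \<Longrightarrow> (\<gamma> has_vector_derivative \<gamma>' t) (at t)"
    "\<And>t. t\<in>{0..1} \<Longrightarrow> \<bar>Lag (\<gamma> t) (\<gamma>' t)\<bar> \<le> B"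
    "((\<lambda>t. Lag (\<gamma> t) (\<gamma>' t)) has_integral c) {0..1}"
    using assms unfolding reaches_def by blast
  define \<delta> where "\<delta> t = (if t \<le> 1/2 then \<gamma> (2 *\<^sub>R t) else x + (2 * t - 1) *\<^sub>R z)" for t :: real
  define \<delta>' where "\<delta>' t = (if t \<le> 1/2 then 2 *\<^sub>R \<gamma>' (2 * t) else 2 *\<^sub>R z)" for t :: real
  define S' where "S' = insert (1/2) ((\<lambda>s. s / 2) ` S)"
  obtain M where M: "\<And>u. norm u \<le> norm x + norm z \<Longrightarrow> \<bar>Lag u z\<bar> \<le> M"
    using locally_boundedD[OF Lag_lb[of z]] by metis
  have lip: "(max (L * 2) (2 * norm z))-lipschitz_on {0..1} \<delta>"
    unfolding \<delta>_def
  proof (rule lipschitz_on_concat_max)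
    have s2: "2-lipschitz_on {0..1/2} (\<lambda>t::real. 2 *\<^sub>R t)"
    proof (rule lipschitz_onI)
      fix s t :: real
      show "dist (2 *\<^sub>R s) (2 *\<^sub>R t) \<le> 2 * dist s t"
        by (cases "s \<le> t") (simp_all add: dist_real_def abs_if)
    qed simp
    have "(\<lambda>t::real. 2 *\<^sub>R t) ` {0..1/2} \<subseteq> {0..1}" by auto
    then show "(L * 2)-lipschitz_on {0..1/2} (\<lambda>t. \<gamma> (2 *\<^sub>R t))"
      using lipschitz_on_compose2[OF s2 lipschitz_on_subset[OF \<gamma>(2)]] by blast
    show "(2 * norm z)-lipschitz_on {1/2..1} (\<lambda>t. x + (2 * t - 1) *\<^sub>R z)"
    proof (rule lipschitz_onI)
      fix s t :: real
      have eq: "(x + (2 * s - 1) *\<^sub>R z) - (x + (2 * t - 1) *\<^sub>R z) = (2 * (s - t)) *\<^sub>R z"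
        by (simp add: algebra_simps)
      show "dist (x + (2 * s - 1) *\<^sub>R z) (x + (2 * t - 1) *\<^sub>R z) \<le> 2 * norm z * dist s t"
        unfolding dist_norm eq by (simp only: norm_scaleR abs_mult real_norm_def) simp
    qed simp
    show "\<gamma> (2 *\<^sub>R (1/2)) = x + (2 * (1/2) - 1) *\<^sub>R z" using \<gamma>(4) by simp
  qed
  have deriv: "(\<delta> has_vector_derivative \<delta>' t) (at t)" if t: "t \<in> {0<..<1} - S'" for t
  proof -
    have "t \<noteq> 1/2" using t by (simp add: S'_def)
    then consider "t < 1/2" | "1/2 < t" by linarith
    then show ?thesis
    proof cases
      case 1
      have "2 * t \<notin> S"
      proof
        assume "2 * t \<in> S"
        then have "(2 * t) / 2 \<in> S'" unfolding S'_def by blast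
        then show False using t by simp
      qed
      then have g: "(\<gamma> has_vector_derivative \<gamma>' (2 * t)) (at (2 *\<^sub>R t))" using t 1 by (simp add: \<gamma>(5))
      have "((\<lambda>t::real. 2 *\<^sub>R t) has_vector_derivative 2) (at t)"
        by (auto intro!: derivative_eq_intros)
      from vector_diff_chain_at[OF this g]
      have "((\<lambda>t. \<gamma> (2 *\<^sub>R t)) has_vector_derivative \<delta>' t) (at t)"
        using 1 by (simp add: \<delta>'_def o_def)
      then show ?thesis
        by (rule has_vector_derivative_transform_within_open[where S="{..<1/2}"])
           (use 1 in \<open>auto simp: \<delta>_def\<close>)
    next
      case 2
      have "((\<lambda>t. x + (2 * t - 1) *\<^sub>R z) has_vector_derivative \<delta>' t) (at t)"
        using 2 by (auto intro!: derivative_eq_intros simp: \<delta>'_def has_vector_derivative_def)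
      then show ?thesis
        by (rule has_vector_derivative_transform_within_open[where S="{1/2<..}"])
           (use 2 in \<open>auto simp: \<delta>_def\<close>)
    qed
  qed
  have left: "Lag (\<delta> t) (\<delta>' t) = 2 * Lag (\<gamma> (2 * t)) (\<gamma>' (2 * t))" if "t \<le> 1/2" for t
    using that by (simp add: \<delta>_def \<delta>'_def Lag_scale)
  have right: "Lag (\<delta> t) (\<delta>' t) = 2 * Lag (x + (2 * t - 1) *\<^sub>R z) z" if "1/2 < t" for t
    using that by (simp add: \<delta>_def \<delta>'_def Lag_scale)
  have bound: "\<bar>Lag (\<delta> t) (\<delta>' t)\<bar> \<le> max (2 * B) (2 * M)" if t: "t \<in> {0..1}" for t
  proof (cases "t \<le> 1/2")
    case True
    then show ?thesis using \<gamma>(6)[of "2 * t"] t by (simp add: left abs_mult)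
  next
    case False
    have "norm (x + (2 * t - 1) *\<^sub>R z) \<le> norm x + \<bar>2 * t - 1\<bar> * norm z"
      using norm_triangle_ineq[of x "(2 * t - 1) *\<^sub>R z"] by simp
    also have "\<bar>2 * t - 1\<bar> * norm z \<le> 1 * norm z" using t False by (intro mult_right_mono) auto
    finally have "\<bar>Lag (x + (2 * t - 1) *\<^sub>R z) z\<bar> \<le> M" by (intro M) simp
    then show ?thesis using False by (simp add: right abs_mult)
  qed
  have "((\<lambda>t. 2 * Lag (\<gamma> (2 * t)) (\<gamma>' (2 * t))) has_integral c) {0..1/2}"
    using has_integral_mult_right[OF has_integral_affinity'[of "\<lambda>t. Lag (\<gamma> t) (\<gamma>' t)" c 0 1 2 0], of 2] \<gamma>(7)
    by simp
  then have "((\<lambda>t. Lag (\<delta> t) (\<delta>' t)) has_integral c) {0..1/2}"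
    by (rule has_integral_eq[rotated]) (simp add: left)
  moreover have "((\<lambda>t. Lag (\<delta> t) (\<delta>' t)) has_integral cost x z) {1/2..1}"
  proof (rule has_integral_spike_finite[of "{1/2}"])
    show "((\<lambda>t. 2 * Lag (x + (2 * t - 1) *\<^sub>R z) z) has_integral cost x z) {1/2..1}"
      using has_integral_mult_right[OF has_integral_affinity'[of "\<lambda>s. Lag (x + s *\<^sub>R z) z" "cost x z" 0 1 2 "-1"], of 2]
        cost_has_integral[of x z] by simp
  qed (auto simp: right)
  ultimately have int: "((\<lambda>t. Lag (\<delta> t) (\<delta>' t)) has_integral (c + cost x z)) {0..1}"
    by (rule has_integral_combine[rotated 2]) auto
  have ends: "\<delta> 0 = a" "\<delta> 1 = x + z" using \<gamma> by (simp_all add: \<delta>_def)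
  have "finite S'" using \<gamma>(1) by (simp add: S'_def)
  then show ?thesis
    unfolding reaches_def using lip deriv bound int ends by blast
qed

definition least_cost :: "real^2 \<Rightarrow> real^2 \<Rightarrow> real" where
  "least_cost a x = Inf {c. reaches Lag a x c}"

text \<open>A lower bound for the action of curves to one point \<open>b\<close> bounds the action of curves to any
  other point from below, since those can be continued to \<open>b\<close> along a segment. So the infimum in
  \<^const>\<open>least_cost\<close> is proper, and \<open>least_cost_step\<close> is the increment estimate required by the
  mollification argument.\<close>

context
  fixes a b :: "real^2" and m :: real
  assumes lower: "\<forall>c. reaches Lag a b c \<longrightarrow> m \<le> c"
begin

lemma reaches_ge: "reaches Lag a x c \<Longrightarrow> m - cost x (b - x) \<le> c"
  using reaches_step[of a x c "b - x"] lower by fastforce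

lemma reaches_any: "reaches Lag a x (cost a (x - a))"
  using reaches_step[OF reaches_start, of a "x - a"] by simp

lemma bdd_below_reaches: "bdd_below {c. reaches Lag a x c}"
  using reaches_ge by (intro bdd_belowI[where m="m - cost x (b - x)"]) auto

lemma least_cost_le: "reaches Lag a x c \<Longrightarrow> least_cost a x \<le> c"
  unfolding least_cost_def by (intro cInf_lower bdd_below_reaches) auto

lemma least_cost_bounds:
  shows "m - cost x (b - x) \<le> least_cost a x" "least_cost a x \<le> cost a (x - a)"
    "least_cost a a \<le> 0" "m \<le> least_cost a b"
proof -
  show "least_cost a x \<le> cost a (x - a)" "least_cost a a \<le> 0"
    by (intro least_cost_le reaches_any reaches_start)+
  have ne: "{c. reaches Lag a u c} \<noteq> {}" for u using reaches_any by blast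
  show "m - cost x (b - x) \<le> least_cost a x" "m \<le> least_cost a b"
    unfolding least_cost_def using reaches_ge lower by (auto intro!: cInf_greatest ne)
qed

lemma least_cost_step: "least_cost a (x + z) \<le> least_cost a x + cost x z"
proof -
  have "least_cost a (x + z) - cost x z \<le> least_cost a x"
    unfolding least_cost_def[of a x]
    using reaches_any least_cost_le[OF reaches_step] by (intro cInf_greatest) (force simp: algebra_simps)+
  then show ?thesis by simp
qed

end

end

section \<open>Calibrations and the mass of a current\<close>

text \<open>The calibration inequality for a mollified vector field. The bounds \<open>g i\<close> on the rows need
  only satisfy the inequality jointly, and may be discontinuous: after convolution only the
  continuous bound \<open>w\<close> is left.\<close>

lemma (in mollifier) mollified_pairing_le:
  fixes f g :: "2 \<Rightarrow> real^2 \<Rightarrow> real" and N :: "real^2^2"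
  assumes f: "\<And>i. continuous_on UNIV (f i)"
    and g: "\<And>i. g i \<in> borel_measurable borel" "\<And>i. locally_bounded (g i)"
    and step: "\<And>i x t. 0 < t \<Longrightarrow> f i (x + t *\<^sub>R N $ i) - f i x \<le> t * segment_mean (g i) x (t *\<^sub>R N $ i)"
    and bound: "\<And>x. (\<Sum>i\<in>UNIV. g i x) \<le> w x * D" and "0 \<le> D"
    and c: "\<And>x. dist x y \<le> \<rho> \<Longrightarrow> w x \<le> c"
  shows "(\<Sum>i\<in>UNIV. \<Sum>k\<in>UNIV. N $ i $ k * partial k (convolution \<eta> (f i)) y) \<le> c * D"
proof -
  have "(\<Sum>i\<in>UNIV. \<Sum>k\<in>UNIV. N $ i $ k * partial k (convolution \<eta> (f i)) y)
      \<le> (\<Sum>i\<in>UNIV. convolution \<eta> (g i) y)"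
    by (intro sum_mono derivative_convolution_le nonneg f g step)
  also have "\<dots> = convolution \<eta> (\<lambda>x. g 1 x + g 2 x) y"
    using integrable_kernel'[OF g] by (simp add: convolution_def sum_2 distrib_left)
  also have "\<dots> \<le> c * D"
  proof (rule convolution_le)
    show "(\<lambda>x. g 1 x + g 2 x) \<in> borel_measurable borel" using g by simp
    show "locally_bounded (\<lambda>x. g 1 x + g 2 x)" by (intro locally_bounded_add g)
    fix x assume "dist x y \<le> \<rho>"
    then have "w x * D \<le> c * D" using c \<open>0 \<le> D\<close> by (intro mult_right_mono)
    then show "g 1 x + g 2 x \<le> c * D" using bound[of x] by (simp add: sum_2)
  qed
  finally show ?thesis .
qed

lemma continuous_dual_norm: "continuous_on UNIV dual_norm"
  unfolding dual_norm_def by (intro continuous_intros)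

lemma dual_norm_nonneg: "0 \<le> dual_norm N"
  unfolding dual_norm_def by (rule max.coboundedI2) simp

text \<open>A cutoff at scale \<open>R\<close> has derivatives of size \<open>1/R\<close>, supported in \<open>R \<le> \<bar>y\<bar> \<le> 4 R\<close>.\<close>

lemma partial_dilated_cutoff:
  fixes \<kappa> :: "real^2 \<Rightarrow> real"
  assumes \<kappa>: "\<And>j. Cj j \<kappa>" "\<And>x. norm x \<le> 1 \<Longrightarrow> \<kappa> x = 1" "\<And>x. 4 < norm x \<Longrightarrow> \<kappa> x = 0"
  obtains M where "0 \<le> M" "\<And>R k y. 0 < R \<Longrightarrow> \<bar>partial k (\<lambda>x. \<kappa> (inverse R *\<^sub>R x)) y\<bar> \<le> M / R"
    "\<And>R k y. 0 < R \<Longrightarrow> norm y < R \<or> 4 * R < norm y \<Longrightarrow> partial k (\<lambda>x. \<kappa> (inverse R *\<^sub>R x)) y = 0"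
proof -
  have chain: "partial k (\<lambda>x. \<kappa> (inverse R *\<^sub>R x)) y = inverse R * partial k \<kappa> (inverse R *\<^sub>R y)" for R k y
  proof -
    have s: "((\<lambda>x. inverse R *\<^sub>R x) has_derivative (\<lambda>x. inverse R *\<^sub>R x)) (at y)"
      by (auto intro!: derivative_eq_intros)
    have d: "(\<kappa> has_derivative frechet_derivative \<kappa> (at u)) (at u)" for u
      using \<kappa>(1)[of 1] by (simp add: frechet_derivative_works[symmetric])
    then have "linear (frechet_derivative \<kappa> (at u))" for u using has_derivative_linear by blast
    then show ?thesis
      using partial_eqI[OF has_derivative_compose[OF s d], of k] by (simp add: partial_def linear_scale)
  qed
  have zero: "partial k \<kappa> x = 0" if x: "norm x < 1 \<or> 4 < norm x" for k x
  proof -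
    define S where "S = (if norm x < 1 then {x. norm x < 1} else {x::real^2. 4 < norm x})"
    have S: "open S" "x \<in> S" using x by (auto simp: S_def intro!: open_Collect_less continuous_intros)
    have "((\<lambda>u. \<kappa> x) has_derivative (\<lambda>v. 0)) (at x)" by simp
    then have "(\<kappa> has_derivative (\<lambda>v. 0)) (at x)"
      by (rule has_derivative_transform_within_open[OF _ S])
         (use x \<kappa>(2,3) in \<open>auto simp: S_def split: if_splits\<close>)
    then show ?thesis by (rule partial_eqI)
  qed
  have c: "continuous_on UNIV (partial k \<kappa>)" for k using \<kappa>(1)[of 1] by simp
  have "\<exists>M\<ge>0. \<forall>x. \<bar>partial k \<kappa> x\<bar> \<le> M" for k
  proof -
    obtain M where "0 \<le> M" "\<And>x. norm x \<le> 4 \<Longrightarrow> \<bar>partial k \<kappa> x\<bar> \<le> M"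
      using locally_boundedD[OF continuous_locally_bounded[OF c]] by metis
    then show ?thesis using zero by (metis abs_zero linorder_not_le)
  qed
  then obtain M where M: "\<And>k. 0 \<le> M k" "\<And>k x. \<bar>partial k \<kappa> x\<bar> \<le> M k" by metis
  show ?thesis
  proof (rule that[of "M 1 + M 2"])
    show "0 \<le> M 1 + M 2" using M(1)[of 1] M(1)[of 2] by simp
    fix R :: real and k y assume R: "0 < R"
    have "M k \<le> M 1 + M 2" using M(1)[of 1] M(1)[of 2] exhaust_2[of k] by auto
    then have "\<bar>partial k \<kappa> (inverse R *\<^sub>R y)\<bar> \<le> M 1 + M 2" using M(2) order_trans by blast
    then show "\<bar>partial k (\<lambda>x. \<kappa> (inverse R *\<^sub>R x)) y\<bar> \<le> (M 1 + M 2) / R"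
      unfolding chain using R by (simp add: abs_mult field_simps)
    assume "norm y < R \<or> 4 * R < norm y"
    then have "norm (inverse R *\<^sub>R y) < 1 \<or> 4 < norm (inverse R *\<^sub>R y)" using R by (simp add: field_simps)
    then show "partial k (\<lambda>x. \<kappa> (inverse R *\<^sub>R x)) y = 0" unfolding chain using zero by simp
  qed
qed

lemma jacobian_cutoff:
  fixes \<kappa> :: "real^2 \<Rightarrow> real" and F :: "2 \<Rightarrow> real^2 \<Rightarrow> real" and N :: "real^2^2"
  assumes "\<And>j. Cj j \<kappa>" "\<And>i j. Cj j (F i)"
  shows "jacobian (\<lambda>x. \<chi> i. \<kappa> x * F i x) (at y) \<bullet> N
     = \<kappa> y * (\<Sum>i\<in>UNIV. \<Sum>k\<in>UNIV. N $ i $ k * partial k (F i) y)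
       + (\<Sum>i\<in>UNIV. \<Sum>k\<in>UNIV. N $ i $ k * partial k \<kappa> y * F i y)"
proof -
  have C: "Cj j (\<lambda>x. \<kappa> x * F i x)" for i j
    using Cj_scaleR[OF assms(1,2)[of j]] by simp
  have "Cj (Suc 0) (\<lambda>x. \<chi> i. \<kappa> x * F i x)"
    by (rule Cj_vector) (use C in simp)
  then have d: "(\<lambda>x. \<chi> i. \<kappa> x * F i x) differentiable (at y)" by simp
  have p: "partial k (\<lambda>x. \<kappa> x * F i x) y = \<kappa> y * partial k (F i) y + partial k \<kappa> y * F i y" for i k
  proof -
    have 1: "(\<kappa> has_derivative frechet_derivative \<kappa> (at y)) (at y)"
      using assms(1)[of 1] by (simp add: frechet_derivative_works[symmetric])
    have 2: "(F i has_derivative frechet_derivative (F i) (at y)) (at y)"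
      using assms(2)[of 1 i] by (simp add: frechet_derivative_works[symmetric])
    show ?thesis using partial_eqI[OF has_derivative_mult[OF 1 2], of k] by (simp add: partial_def)
  qed
  have "jacobian (\<lambda>x. \<chi> i. \<kappa> x * F i x) (at y) $ i $ k = \<kappa> y * partial k (F i) y + partial k \<kappa> y * F i y" for i k
    unfolding jacobian_eq_partials[OF d] by (simp add: p)
  then show ?thesis by (simp add: inner_vec_def sum_2 algebra_simps)
qed

lemma abs_le_of_nearby:
  assumes m: "mollifier \<eta> \<epsilon>" and f: "continuous_on UNIV f" and near: "\<And>x. dist x y \<le> \<epsilon> \<Longrightarrow> \<bar>f x - a\<bar> \<le> c"
  shows "\<bar>convolution \<eta> f y - a\<bar> \<le> c"
proof -
  interpret mollifier \<eta> \<epsilon> by (rule m)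
  have "f \<in> borel_measurable borel" "locally_bounded f"
    using f by (auto intro: borel_measurable_continuous_onI continuous_locally_bounded)
  from convolution_le[OF this, of y "a + c"] convolution_ge[OF this, of y "a - c"] near
  show ?thesis by (force simp: abs_le_iff)
qed

text \<open>A vector field with components \<open>f 1\<close>, \<open>f 2\<close> that satisfies the calibration inequality in the
  weak sense of increments bounds the integral of \<open>w dual_norm\<close> over a current from below. The
  test field is the mollification of \<open>f\<close> times a cutoff. At scale \<open>R\<close> the derivative of the cutoff
  contributes at most a constant times \<open>\<bar>y\<bar>\<close> to the power \<open>p\<close> on \<open>\<bar>y\<bar> \<ge> R\<close>, as the factor \<open>1/R\<close>
  compensates one power of \<open>\<bar>y\<bar> \<le> 4 R\<close>. The mollification is removed first, with \<open>R\<close> fixed, and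
  then \<open>R \<rightarrow> \<infinity>\<close>.\<close>

theorem calibration_bound:
  fixes T :: "(real^2 \<Rightarrow> real^2^2) \<Rightarrow> real" and f :: "2 \<Rightarrow> real^2 \<Rightarrow> real"
  assumes T: "T \<in> C0_currents am ap" and pd: "polar_decomposition T \<mu> \<tau>"
    and tr: "AE y in completion \<mu>. trace (\<tau> y) = 0"
    and w: "continuous_on UNIV w" "\<And>y. 0 \<le> w y"
    and I: "integrable (completion \<mu>) (\<lambda>y. w y * dual_norm (\<tau> y))"
    and f: "\<And>i. continuous_on UNIV (f i)"
    and calib: "\<And>N. trace N = 0 \<Longrightarrow> \<exists>g. (\<forall>i. g i \<in> borel_measurable borel \<and> locally_bounded (g i) \<and>
       (\<forall>x t. 0 < t \<longrightarrow> f i (x + t *\<^sub>R N $ i) - f i x \<le> t * segment_mean (g i) x (t *\<^sub>R N $ i))) \<and>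
       (\<forall>x. (\<Sum>i\<in>UNIV. g i x) \<le> w x * dual_norm N)"
    and growth: "\<And>i y. r \<le> norm y \<Longrightarrow> \<bar>f i y\<bar> \<le> K * norm y powr (1 + p)"
      "\<And>y. r \<le> norm y \<Longrightarrow> norm y powr p \<le> K * w y"
    and pos: "0 < p" "0 \<le> K"
  shows "f 1 ap - f 1 am \<le> (\<integral>y. w y * dual_norm (\<tau> y) \<partial>completion \<mu>)"
proof -
  let ?M = "completion \<mu>"
  let ?I = "\<integral>y. w y * dual_norm (\<tau> y) \<partial>?M"
  have sets: "sets \<mu> = sets borel" and fin: "\<And>C. compact C \<Longrightarrow> emeasure \<mu> C < \<infinity>"
    and unit: "AE y in \<mu>. norm (\<tau> y) = 1"
    and rep: "\<And>\<zeta>. \<zeta> \<in> test_fun \<Longrightarrow> T \<zeta> = (\<integral>y. \<zeta> y \<bullet> \<tau> y \<partial>?M)"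
    using pd unfolding polar_decomposition_def by auto
  have setsM: "A \<in> sets ?M" if "A \<in> sets borel" for A using that sets by auto
  obtain \<kappa> :: "real^2 \<Rightarrow> real" where \<kappa>: "\<And>j. Cj j \<kappa>" "\<And>x. \<kappa> x \<in> {0..1}"
    "\<And>x. norm x \<le> 1 \<Longrightarrow> \<kappa> x = 1" "\<And>x. 4 < norm x \<Longrightarrow> \<kappa> x = 0"
    using smooth_cutoff_exists by blast
  obtain M where M: "0 \<le> M" "\<And>R k y. 0 < R \<Longrightarrow> \<bar>partial k (\<lambda>x. \<kappa> (inverse R *\<^sub>R x)) y\<bar> \<le> M / R"
    "\<And>R k y. 0 < R \<Longrightarrow> norm y < R \<or> 4 * R < norm y \<Longrightarrow> partial k (\<lambda>x. \<kappa> (inverse R *\<^sub>R x)) y = 0"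
    using partial_dilated_cutoff[OF \<kappa>(1,3,4)] by blast
  define r0 where "r0 = \<bar>r\<bar> + norm am + norm ap + 1"
  have r0: "r + 1 \<le> r0" "norm am \<le> r0" "norm ap \<le> r0" "1 \<le> r0"
    unfolding r0_def using norm_ge_zero[of am] norm_ge_zero[of ap] by linarith+
  \<comment> \<open>four entries of the matrix; a factor \<open>4\<close> from \<open>\<bar>y\<bar> \<le> 4 R\<close>; \<open>2 powr (1 + p)\<close> since a point at
    distance at most \<open>1\<close> from \<open>y\<close> has norm at most \<open>2 \<bar>y\<bar>\<close>; one \<open>K\<close> for the growth of \<open>f\<close> and one
    for the passage to \<open>w\<close>\<close>
  define K' where "K' = 16 * M * K * 2 powr (1 + p) * K"
  have K': "0 \<le> K'" using M(1) pos by (simp add: K'_def)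
  define tail where "tail R = (\<integral>y. indicator {y. R \<le> norm y} y * (w y * dual_norm (\<tau> y)) \<partial>?M)" for R :: real
  have int_tail: "integrable ?M (\<lambda>y. indicator {y. R \<le> norm y} y * (w y * dual_norm (\<tau> y)))" for R
    using integrable_mult_indicator[OF setsM I, of "{y. R \<le> norm y}"] by simp
  have main: "f 1 ap - f 1 am \<le> ?I + K' * tail R + \<delta> * (2 + 2 * measure ?M (cball 0 (4 * R)))"
    if R: "r0 \<le> R" and \<delta>: "0 < \<delta>" for R \<delta>
  proof -
    have "compact (cball (0::real^2) (4 * R + 1))" by simp
    then have "uniformly_continuous_on (cball 0 (4 * R + 1)) w"
      using continuous_on_subset[OF w(1)] by (intro compact_uniformly_continuous) auto
    then obtain e1 where e1: "e1 > 0" "\<And>x y. x \<in> cball 0 (4 * R + 1) \<Longrightarrow> y \<in> cball 0 (4 * R + 1) \<Longrightarrow> dist x y < e1 \<Longrightarrow> dist (w x) (w y) < \<delta>"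
      unfolding uniformly_continuous_on_def using \<delta> by metis
    have "\<exists>e>0. \<forall>x. dist x y < e \<longrightarrow> \<bar>f 1 x - f 1 y\<bar> < \<delta>" for y
      using f[of 1] \<delta> unfolding continuous_on_eq_continuous_at[OF open_UNIV] continuous_at_eps_delta
      by (simp add: dist_real_def)
    then obtain e2 e3 where e2: "e2 > 0" "\<And>x. dist x ap < e2 \<Longrightarrow> \<bar>f 1 x - f 1 ap\<bar> < \<delta>"
      and e3: "e3 > 0" "\<And>x. dist x am < e3 \<Longrightarrow> \<bar>f 1 x - f 1 am\<bar> < \<delta>" by metis
    \<comment> \<open>so small that on the support of the cutoff \<open>w\<close> varies by less than \<open>\<delta>\<close> at distance \<open>\<epsilon>\<close>, and
      so does \<open>f 1\<close> near the two endpoints\<close>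
    define \<epsilon> where "\<epsilon> = Min {1, e1, e2, e3} / 2"
    have \<epsilon>: "0 < \<epsilon>" "\<epsilon> < 1" "\<epsilon> < e1" "\<epsilon> < e2" "\<epsilon> < e3" using e1(1) e2(1) e3(1) by (auto simp: \<epsilon>_def)
    obtain \<eta> where mol: "mollifier \<eta> \<epsilon>" using mollifier_exists[OF \<epsilon>(1)] by blast
    then interpret mollifier \<eta> \<epsilon> .
    define F where "F i = convolution \<eta> (f i)" for i
    define k where "k x = \<kappa> (inverse R *\<^sub>R x)" for x
    define \<xi> where "\<xi> x = (\<chi> i. k x * F i x)" for x
    have Rpos: "0 < R" using R r0 by linarith
    have CF: "Cj j (F i)" for i j unfolding F_def by (rule Cj_convolution[OF kernel_axioms f])
    have Ck: "Cj j k" for j unfolding k_def by (rule Cj_dilation[OF \<kappa>(1)])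
    have k01: "k x \<in> {0..1}" for x unfolding k_def by (rule \<kappa>(2))
    have k1: "k x = 1" if "norm x \<le> R" for x unfolding k_def using that Rpos by (intro \<kappa>(3)) (simp add: field_simps)
    have k0: "k x = 0" if "4 * R < norm x" for x unfolding k_def using that Rpos by (intro \<kappa>(4)) (simp add: field_simps)
    have C\<xi>: "Cj j (\<lambda>x. \<xi> x $ i)" for i j using Cj_scaleR[OF Ck CF] by (simp add: \<xi>_def)
    have van: "\<xi> x = 0" if "4 * R < norm x" for x using k0[OF that] by (simp add: \<xi>_def vec_eq_iff)
    have "\<xi> \<in> test_fun" using Cj_vector[OF C\<xi>] van by (rule test_funI)
    then have "T (\<lambda>x. jacobian \<xi> (at x)) = \<xi> ap $ 1 - \<xi> am $ 1"
      using T unfolding C0_currents_def bdry_def by blast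
    also have "\<dots> = F 1 ap - F 1 am"
      using k1 r0 R by (simp add: \<xi>_def)
    finally have TF: "(\<integral>y. jacobian \<xi> (at y) \<bullet> \<tau> y \<partial>?M) = F 1 ap - F 1 am"
      using rep[OF jacobian_test_fun[OF C\<xi> van]] by simp
    have pair: "(\<Sum>i\<in>UNIV. \<Sum>k\<in>UNIV. N $ i $ k * partial k (F i) y) \<le> (w y + \<delta>) * dual_norm N"
      if N: "trace N = 0" and y: "norm y \<le> 4 * R" for N y
    proof -
      obtain g where g: "\<And>i. g i \<in> borel_measurable borel" "\<And>i. locally_bounded (g i)"
        "\<And>i x t. 0 < t \<Longrightarrow> f i (x + t *\<^sub>R N $ i) - f i x \<le> t * segment_mean (g i) x (t *\<^sub>R N $ i)"
        "\<And>x. (\<Sum>i\<in>UNIV. g i x) \<le> w x * dual_norm N" using calib[OF N] by blast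
      show ?thesis unfolding F_def
      proof (rule mollified_pairing_le[OF f g dual_norm_nonneg])
        fix x assume x: "dist x y \<le> \<epsilon>"
        have "norm x \<le> norm y + dist x y" using norm_triangle_ineq2[of x y] by (simp add: dist_norm)
        then have "dist (w x) (w y) < \<delta>" using x y \<epsilon> by (intro e1(2)) auto
        then show "w x \<le> w y + \<delta>" by (simp add: dist_real_def)
      qed
    qed
    have err: "(\<Sum>i\<in>UNIV. \<Sum>j\<in>UNIV. N $ i $ j * partial j k y * F i y)
        \<le> K' * (indicator {y. R \<le> norm y} y * (w y * dual_norm N))"
      if N: "trace N = 0" "norm N = 1" for N :: "real^2^2" and y
    proof (cases "R \<le> norm y \<and> norm y \<le> 4 * R")
      case True
      have Fb: "\<bar>F i y\<bar> \<le> K * (2 * norm y) powr (1 + p)" for i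
      proof -
        have "\<bar>convolution \<eta> (f i) y - 0\<bar> \<le> K * (2 * norm y) powr (1 + p)"
        proof (rule abs_le_of_nearby[OF mol f])
          fix x assume x: "dist x y \<le> \<epsilon>"
          have "norm x \<le> norm y + dist x y" "norm y \<le> norm x + dist x y"
            using norm_triangle_ineq2[of x y] norm_triangle_ineq2[of y x]
            by (simp_all add: dist_norm norm_minus_commute)
          then have n: "r \<le> norm x" "norm x \<le> 2 * norm y" using x \<epsilon> True r0 R by linarith+
          have "\<bar>f i x\<bar> \<le> K * norm x powr (1 + p)" by (rule growth(1)[OF n(1)])
          also have "\<dots> \<le> K * (2 * norm y) powr (1 + p)"
            using n pos by (intro mult_left_mono powr_mono2) auto
          finally show "\<bar>f i x - 0\<bar> \<le> K * (2 * norm y) powr (1 + p)" by simp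
        qed
        then show ?thesis by (simp add: F_def)
      qed
      have y: "0 < norm y" using True Rpos by linarith
      have one: "N $ i $ j * partial j k y * F i y \<le> K' / 4 * (w y * dual_norm N)" for i j
      proof -
        have Nij: "\<bar>N $ i $ j\<bar> \<le> 1"
          using component_le_norm_cart[of "N $ i" j] Finite_Cartesian_Product.norm_nth_le[of N i] N(2) by linarith
        have "N $ i $ j * partial j k y * F i y \<le> \<bar>N $ i $ j\<bar> * \<bar>partial j k y\<bar> * \<bar>F i y\<bar>"
          by (metis abs_ge_self abs_mult)
        also have "\<dots> \<le> 1 * (M / R) * (K * (2 * norm y) powr (1 + p))"
          using M(1) M(2)[OF Rpos, of j y] Nij Fb[of i] Rpos unfolding k_def[abs_def, symmetric]
          by (intro mult_mono) auto
        also have "\<dots> = M * K * 2 powr (1 + p) * (norm y / R) * norm y powr p"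
          using y by (simp add: powr_mult powr_add)
        also have "\<dots> \<le> M * K * 2 powr (1 + p) * 4 * (K * w y)"
          using M(1) pos True Rpos growth(2)[of y] R r0 by (intro mult_mono) (auto simp: field_simps)
        also have "\<dots> = K' / 4 * (w y * 1)" by (simp add: K'_def)
        also have "\<dots> \<le> K' / 4 * (w y * dual_norm N)"
          using K' w(2)[of y] dual_norm_trace_free(1)[OF N(1)] N(2) by (intro mult_left_mono) auto
        finally show ?thesis .
      qed
      have "(\<Sum>i\<in>UNIV. \<Sum>j\<in>UNIV. N $ i $ j * partial j k y * F i y)
          \<le> (\<Sum>i\<in>(UNIV::2 set). \<Sum>j\<in>(UNIV::2 set). K' / 4 * (w y * dual_norm N))"
        by (intro sum_mono one)
      then show ?thesis using True by (simp add: mult_ac)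
    next
      case False
      then have "partial j k y = 0" for j
        using M(3)[OF Rpos, of y j] unfolding k_def[abs_def] by auto
      then show ?thesis using K' w(2)[of y] dual_norm_nonneg[of N] by simp
    qed
    have "AE y in ?M. jacobian \<xi> (at y) \<bullet> \<tau> y
        \<le> w y * dual_norm (\<tau> y) + K' * (indicator {y. R \<le> norm y} y * (w y * dual_norm (\<tau> y)))
          + 2 * \<delta> * indicator (cball 0 (4 * R)) y"
      using tr AE_completion[OF unit]
    proof eventually_elim
      fix y assume t: "trace (\<tau> y) = 0" "norm (\<tau> y) = 1"
      have "k y * (\<Sum>i\<in>UNIV. \<Sum>j\<in>UNIV. \<tau> y $ i $ j * partial j (F i) y)
          \<le> w y * dual_norm (\<tau> y) + 2 * \<delta> * indicator (cball 0 (4 * R)) y"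
      proof (cases "norm y \<le> 4 * R")
        case True
        have "k y * (\<Sum>i\<in>UNIV. \<Sum>j\<in>UNIV. \<tau> y $ i $ j * partial j (F i) y)
            \<le> k y * ((w y + \<delta>) * dual_norm (\<tau> y))"
          using k01[of y] by (intro mult_left_mono pair t True) auto
        also have "\<dots> \<le> 1 * ((w y + \<delta>) * dual_norm (\<tau> y))"
          using k01[of y] w(2)[of y] \<delta> dual_norm_nonneg[of "\<tau> y"] by (intro mult_right_mono) auto
        also have "\<dots> \<le> w y * dual_norm (\<tau> y) + \<delta> * 2"
          using dual_norm_trace_free(2)[OF t(1)] t(2) \<delta> by (simp add: distrib_right)
        finally show ?thesis using True by simp
      next
        case False
        then show ?thesis using k0[of y] w(2)[of y] dual_norm_nonneg[of "\<tau> y"] by simp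
      qed
      then show "jacobian \<xi> (at y) \<bullet> \<tau> y
        \<le> w y * dual_norm (\<tau> y) + K' * (indicator {y. R \<le> norm y} y * (w y * dual_norm (\<tau> y)))
          + 2 * \<delta> * indicator (cball 0 (4 * R)) y"
        unfolding \<xi>_def[abs_def] jacobian_cutoff[OF Ck CF] using err[OF t, of y] by linarith
    qed
    note ae = this
    have cb: "cball 0 (4 * R) \<in> sets ?M" by (rule setsM) simp
    have cbf: "emeasure ?M (cball 0 (4 * R)) < \<infinity>"
      using fin[OF compact_cball] sets by (subst emeasure_completion) auto
    let ?G = "\<lambda>y. w y * dual_norm (\<tau> y) + K' * (indicator {y. R \<le> norm y} y * (w y * dual_norm (\<tau> y)))
          + 2 * \<delta> * indicator (cball 0 (4 * R)) y"
    have ind: "integrable ?M (\<lambda>y. 2 * \<delta> * indicator (cball 0 (4 * R)) y)"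
      using cb cbf by (intro integrable_mult_right integrable_real_indicator)
    have intG: "integrable ?M ?G"
      by (intro Bochner_Integration.integrable_add I ind integrable_mult_right int_tail)
    \<comment> \<open>if the left integrand is not integrable, its integral is \<open>0\<close> by convention, and \<open>?G\<close> is
      nonnegative\<close>
    have "(\<integral>y. jacobian \<xi> (at y) \<bullet> \<tau> y \<partial>?M) \<le> (\<integral>y. ?G y \<partial>?M)"
    proof (cases "integrable ?M (\<lambda>y. jacobian \<xi> (at y) \<bullet> \<tau> y)")
      case True
      then show ?thesis using intG ae by (rule integral_mono_AE)
    next
      case False
      have "0 \<le> ?G y" for y using w(2)[of y] K' \<delta> dual_norm_nonneg[of "\<tau> y"] by simp
      then show ?thesis using not_integrable_integral_eq[OF False] by (simp add: integral_nonneg)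
    qed
    also have "\<dots> = ?I + K' * tail R + 2 * \<delta> * measure ?M (cball 0 (4 * R))"
      using I ind int_tail[of R] cb sets_eq_imp_space_eq[OF sets] by (simp add: tail_def)
    finally have "F 1 ap - F 1 am \<le> ?I + K' * tail R + 2 * \<delta> * measure ?M (cball 0 (4 * R))"
      unfolding TF .
    moreover have "\<bar>F 1 ap - f 1 ap\<bar> \<le> \<delta>" "\<bar>F 1 am - f 1 am\<bar> \<le> \<delta>"
      unfolding F_def using \<epsilon> order_le_less_trans[OF _ \<epsilon>(4)] order_le_less_trans[OF _ \<epsilon>(5)]
      by (auto intro!: abs_le_of_nearby[OF mol f] less_imp_le[OF e2(2)] less_imp_le[OF e3(2)])
    ultimately show ?thesis by (simp add: algebra_simps)
  qed
  have le_tail: "f 1 ap - f 1 am \<le> ?I + K' * tail R" if R: "r0 \<le> R" for R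
  proof (rule field_le_epsilon)
    fix e :: real assume e: "0 < e"
    define c where "c = 2 + 2 * measure ?M (cball (0::real^2) (4 * R))"
    have c: "0 < c" by (simp add: c_def add_pos_nonneg)
    show "f 1 ap - f 1 am \<le> ?I + K' * tail R + e"
      using main[OF R, of "e / c"] e c unfolding c_def[symmetric] by simp
  qed
  have "(\<lambda>n. tail (real n)) \<longlonglongrightarrow> (\<integral>y. 0 \<partial>?M)"
    unfolding tail_def
  proof (rule integral_dominated_convergence[where w="\<lambda>y. w y * dual_norm (\<tau> y)"])
    show "AE y in ?M. (\<lambda>n. indicator {y. real n \<le> norm y} y * (w y * dual_norm (\<tau> y))) \<longlonglongrightarrow> 0"
    proof (rule AE_I2)
      fix y :: "real^2"
      have "eventually (\<lambda>n. norm y < real n) sequentially"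
        using filterlim_at_top_dense filterlim_real_sequentially by blast
      then have "eventually (\<lambda>n. 0 = indicator {y. real n \<le> norm y} y * (w y * dual_norm (\<tau> y))) sequentially"
        by eventually_elim simp
      then show "(\<lambda>n. indicator {y. real n \<le> norm y} y * (w y * dual_norm (\<tau> y))) \<longlonglongrightarrow> 0"
        by (rule Lim_transform_eventually[OF tendsto_const])
    qed
    show "AE y in ?M. norm (indicator {y. real n \<le> norm y} y * (w y * dual_norm (\<tau> y))) \<le> w y * dual_norm (\<tau> y)" for n
      using w(2) dual_norm_nonneg by (intro AE_I2) (auto simp: indicator_def)
  qed (use I int_tail borel_measurable_integrable in auto)
  then have "(\<lambda>n. ?I + K' * tail (real n)) \<longlonglongrightarrow> ?I + K' * 0" by (intro tendsto_intros) simp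
  moreover have "eventually (\<lambda>n. f 1 ap - f 1 am \<le> ?I + K' * tail (real n)) sequentially"
    using le_tail by (intro eventually_sequentiallyI[of "nat \<lceil>r0\<rceil>"]) (simp add: nat_ceiling_le_eq)
  ultimately show ?thesis using tendsto_lowerbound[of _ "?I + K' * 0" sequentially] by simp
qed

section \<open>The lower bound\<close>

lemma norm_partials_le_norm_D:
  fixes \<phi> :: "real^2 \<Rightarrow> real"
  shows "norm (foldr partial is \<phi> y) \<le> norm_D (length is) \<phi> y"
proof -
  have fin: "finite {js :: 2 list. length js = length is}"
    using finite_lists_length_eq[of "UNIV :: 2 set" "length is"] by simp
  have "(norm (foldr partial is \<phi> y))\<^sup>2
      \<le> (\<Sum>js | length js = length is. (norm (foldr partial js \<phi> y))\<^sup>2)"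
    by (rule member_le_sum[OF _ _ fin]) auto
  then show ?thesis unfolding norm_D_def by (rule real_le_rsqrt)
qed

text \<open>At the finitely many exceptional times and at the endpoints of \<open>[0,1]\<close> \<^const>\<open>vector_derivative\<close>
  may be an unspecified value. The action is not affected: the integrand stays bounded and changes
  on a finite set only.\<close>

lemma reaches_imp_integral:
  assumes "reaches Lag a x c"
  obtains \<gamma> where "\<gamma> \<in> Gamma1 a x"
    "(\<integral>t. Lag (\<gamma> t) (vector_derivative \<gamma> (at t within {0..1})) \<partial>lebesgue_on {0..1}) = c"
proof -
  obtain \<gamma> \<gamma>' S B L where \<gamma>: "finite S" "L-lipschitz_on {0..1} \<gamma>" "\<gamma> 0 = a" "\<gamma> 1 = x"
    "\<And>t. t\<in>{0<..<1} - S \<Longrightarrow> (\<gamma> has_vector_derivative \<gamma>' t) (at t)"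
    "\<And>t. t\<in>{0..1} \<Longrightarrow> \<bar>Lag (\<gamma> t) (\<gamma>' t)\<bar> \<le> B"
    "((\<lambda>t. Lag (\<gamma> t) (\<gamma>' t)) has_integral c) {0..1}"
    using assms unfolding reaches_def by blast
  define S' where "S' = insert 0 (insert 1 S)"
  have S': "finite S'" using \<gamma>(1) by (simp add: S'_def)
  define k where "k t = Lag (\<gamma> t) (vector_derivative \<gamma> (at t within {0..1}))" for t
  have eq: "k t = Lag (\<gamma> t) (\<gamma>' t)" if "t \<in> {0..1} - S'" for t
  proof -
    have "t \<in> {0<..<1} - S" using that by (auto simp: S'_def less_le)
    then show ?thesis
      unfolding k_def using vector_derivative_at_within_ivl[OF \<gamma>(5), of t 0 1] by simp
  qed
  have int: "(k has_integral c) {0..1}"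
    by (rule has_integral_spike_finite[OF S' _ \<gamma>(7)]) (use eq in auto)
  have bound: "norm (k t) \<le> \<bar>B\<bar> + (\<Sum>s\<in>S'. \<bar>k s\<bar>)" if t: "t \<in> {0..1}" for t
  proof (cases "t \<in> S'")
    case True
    then have "\<bar>k t\<bar> \<le> (\<Sum>s\<in>S'. \<bar>k s\<bar>)" by (intro member_le_sum S') auto
    then show ?thesis by simp
  next
    case False
    then have "\<bar>k t\<bar> \<le> B" using eq \<gamma>(6) t by simp
    moreover have "0 \<le> (\<Sum>s\<in>S'. \<bar>k s\<bar>)" by (simp add: sum_nonneg)
    ultimately show ?thesis unfolding real_norm_def by linarith
  qed
  have "integrable (lebesgue_on {0..1}) k"
  proof (rule measurable_bounded_by_integrable_imp_lebesgue_integrable[OF _ _ bound])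
    show "k \<in> borel_measurable (lebesgue_on {0..1})"
      using int by (intro integrable_imp_measurable) (rule has_integral_integrable)
    show "integrable (lebesgue_on {0..1::real}) (\<lambda>t. \<bar>B\<bar> + (\<Sum>s\<in>S'. \<bar>k s\<bar>))"
      by (rule finite_measure.integrable_const) (simp add: finite_measure_lebesgue_on)
  qed auto
  then have "(\<integral>t. k t \<partial>lebesgue_on {0..1}) = c"
    using lebesgue_integral_eq_integral[of "{0..1}" k] int by (simp add: integral_unique)
  moreover have "\<gamma> \<in> Gamma1 a x" using \<gamma> unfolding Gamma1_def by blast
  ultimately show ?thesis using that unfolding k_def by blast
qed

lemma (in lagrangian) cost_bound:
  assumes "\<And>u. norm u \<le> r \<Longrightarrow> \<bar>Lag u z\<bar> \<le> B" "norm x + norm z \<le> r"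
  shows "\<bar>cost x z\<bar> \<le> B"
proof -
  have n: "norm (x + s *\<^sub>R z) \<le> r" if "s \<in> {0..1}" for s
  proof -
    have "norm (x + s *\<^sub>R z) \<le> norm x + \<bar>s\<bar> * norm z" using norm_triangle_ineq[of x "s *\<^sub>R z"] by simp
    also have "\<bar>s\<bar> * norm z \<le> 1 * norm z" using that by (intro mult_right_mono) auto
    finally show ?thesis using assms(2) by simp
  qed
  have "0 \<le> B" using assms n[of 0] by (meson abs_ge_zero atLeastAtMost_iff order_trans zero_le_one order_refl)
  have "\<And>s. s \<in> {0..1} \<Longrightarrow> Lag (x + s *\<^sub>R z) z \<le> B" "\<And>s. s \<in> {0..1} \<Longrightarrow> - Lag (x + s *\<^sub>R z) z \<le> B"
    using assms(1)[OF n] by (force simp: abs_le_iff)+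
  then have "cost x z \<le> B" "segment_mean (\<lambda>u. - Lag u z) x z \<le> B"
    unfolding cost_def using Lag_lb[of z] by (auto intro!: segment_mean_le simp: locally_bounded_def)
  then show ?thesis by (simp add: abs_le_iff cost_def segment_mean_def)
qed

lemma (in lagrangian) least_cost_continuous:
  assumes lower: "\<forall>c. reaches Lag a b c \<longrightarrow> m \<le> c"
    and lin: "\<And>r. \<exists>B. \<forall>u z. norm u \<le> r \<longrightarrow> \<bar>Lag u z\<bar> \<le> B * norm z"
  shows "continuous_on UNIV (least_cost a)"
proof -
  have "isCont (least_cost a) y" for y
  proof -
    obtain B where B: "\<And>u z. norm u \<le> norm y + 2 \<Longrightarrow> \<bar>Lag u z\<bar> \<le> B * norm z" using lin by blast
    have near: "norm (least_cost a u - least_cost a y) \<le> B * dist u y" if u: "dist u y < 1" for u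
    proof -
      have n: "norm u \<le> norm y + 1" using norm_triangle_ineq2[of u y] u by (simp add: dist_norm)
      have d: "norm (y - u) \<le> 1" "norm (u - y) \<le> 1"
        using u by (simp_all add: dist_norm norm_minus_commute)
      have "\<bar>cost u (y - u)\<bar> \<le> B * norm (y - u)"
        by (rule cost_bound[where r="norm y + 2", OF B]) (use n d in linarith)+
      moreover have "\<bar>cost y (u - y)\<bar> \<le> B * norm (u - y)"
        by (rule cost_bound[where r="norm y + 2", OF B]) (use n d in linarith)+
      moreover have "least_cost a y \<le> least_cost a u + cost u (y - u)" "least_cost a u \<le> least_cost a y + cost y (u - y)"
        using least_cost_step[OF lower, of u "y - u"] least_cost_step[OF lower, of y "u - y"] by auto
      ultimately show ?thesis by (simp add: dist_norm norm_minus_commute abs_le_iff)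
    qed
    have ev: "eventually (\<lambda>u. norm (least_cost a u - least_cost a y) \<le> B * dist u y) (at y)"
      unfolding eventually_at by (intro exI[of _ 1] conjI ballI impI near) auto
    have "((\<lambda>u. B * dist u y) \<longlongrightarrow> B * dist y y) (at y)" by (intro tendsto_intros)
    then have "((\<lambda>u. B * dist u y) \<longlongrightarrow> 0) (at y)" by simp
    from Lim_null_comparison[OF ev this]
    have "((\<lambda>u. least_cost a u - least_cost a y) \<longlongrightarrow> 0) (at y)" .
    then show ?thesis unfolding isCont_def by (rule LIM_zero_cancel)
  qed
  then show ?thesis by (simp add: continuous_at_imp_continuous_on)
qed

lemma segment_mean_linear:
  assumes "f \<in> borel_measurable borel" "locally_bounded f" "g \<in> borel_measurable borel" "locally_bounded g"
  shows "segment_mean (\<lambda>x. a * f x + b * g x) x z = a * segment_mean f x z + b * segment_mean g x z"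
proof -
  have "segment_mean (\<lambda>x. a * f x + b * g x) x z
      = (\<integral>s. a * (indicator {0..1} s * f (x + s *\<^sub>R z)) + b * (indicator {0..1} s * g (x + s *\<^sub>R z)) \<partial>lborel)"
    unfolding segment_mean_def by (intro Bochner_Integration.integral_cong) (auto simp: algebra_simps)
  also have "\<dots> = a * segment_mean f x z + b * segment_mean g x z"
    using integrable_segment[OF assms(1,2), of x z] integrable_segment[OF assms(3,4), of x z]
    by (simp add: segment_mean_def)
  finally show ?thesis .
qed

lemma ennreal_sqrt_F_star:
  assumes "0 \<le> W y"
  shows "ennreal_sqrt (F_star W y N)
    = (if trace N = 0 then ennreal (1/2 * sqrt (W y) * dual_norm N) else \<infinity>)"
proof (cases "trace N = 0")
  case True
  let ?m = "max ((norm N)\<^sup>2 - 2 * det N) ((N$1$2 - N$2$1)\<^sup>2)"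
  have m: "0 \<le> ?m" by (rule max.coboundedI2) simp
  have "sqrt (1/4 * W y * ?m) = sqrt (1/4) * sqrt (W y) * sqrt ?m" by (simp only: real_sqrt_mult)
  also have "sqrt (1/4) = 1/2" by (rule real_sqrt_unique) (simp_all add: power2_eq_square)
  also have "sqrt ?m = dual_norm N" using dual_norm_trace_free(3)[OF True] by simp
  finally have eq: "sqrt (1/4 * W y * ?m) = 1/2 * sqrt (W y) * dual_norm N" .
  have "ennreal_sqrt (ennreal x) = ennreal (sqrt x)" if "0 \<le> x" for x
    using that by (simp add: ennreal_sqrt_def)
  from this[of "1/4 * W y * ?m"] show ?thesis
    unfolding F_star_def eq if_P[OF True] using assms m by simp
qed (simp add: ennreal_sqrt_def F_star_def)

text \<open>A finite \<open>F\<close>-mass forces the orientation to be trace free almost everywhere; this is where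
  the value \<open>\<infinity>\<close> of \<open>F\<^sup>*\<close> enters.\<close>

lemma F_mass_finite_imp:
  assumes pd: "polar_decomposition T \<mu> \<tau>" and W: "continuous_on UNIV W" "\<And>y. 0 \<le> W y"
    and fin: "F_mass W \<mu> \<tau> \<noteq> \<infinity>"
  shows "AE y in completion \<mu>. trace (\<tau> y) = 0"
    and "integrable (completion \<mu>) (\<lambda>y. 1/2 * sqrt (W y) * dual_norm (\<tau> y))"
    and "F_mass W \<mu> \<tau> = ennreal (\<integral>y. 1/2 * sqrt (W y) * dual_norm (\<tau> y) \<partial>completion \<mu>)"
proof -
  let ?M = "completion \<mu>"
  let ?w = "\<lambda>y. 1/2 * sqrt (W y) * dual_norm (\<tau> y)"
  define \<Phi> where "\<Phi> y = (if trace (\<tau> y) = 0 then ennreal (?w y) else \<infinity>)" for y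
  have sets: "sets \<mu> = sets borel" and \<tau> [measurable]: "\<tau> \<in> borel_measurable ?M"
    using pd unfolding polar_decomposition_def by auto
  have "W \<in> borel_measurable \<mu>"
    using borel_measurable_continuous_onI[OF W(1)] sets by (simp cong: measurable_cong_sets)
  then have [measurable]: "W \<in> borel_measurable ?M" by (rule measurable_completion)
  have [measurable]: "(\<lambda>y. dual_norm (\<tau> y)) \<in> borel_measurable ?M"
    using borel_measurable_continuous_onI[OF continuous_dual_norm] \<tau> by (rule measurable_compose[rotated])
  have "continuous_on UNIV (trace :: real^2^2 \<Rightarrow> real)"
    unfolding trace_def by (intro continuous_intros)
  then have [measurable]: "(\<lambda>y. trace (\<tau> y)) \<in> borel_measurable ?M"
    using \<tau> by (intro measurable_compose[OF \<tau>] borel_measurable_continuous_onI)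
  have F: "F_mass W \<mu> \<tau> = (\<integral>\<^sup>+ y. \<Phi> y \<partial>?M)"
    unfolding F_mass_def \<Phi>_def by (intro nn_integral_cong) (simp add: ennreal_sqrt_F_star W(2))
  have "AE y in ?M. \<Phi> y \<noteq> \<infinity>"
  proof (rule nn_integral_noteq_infinite)
    show "\<Phi> \<in> borel_measurable ?M" unfolding \<Phi>_def by measurable
  qed (use F fin in simp)
  then show tr: "AE y in ?M. trace (\<tau> y) = 0" by eventually_elim (auto simp: \<Phi>_def split: if_splits)
  then have "(\<integral>\<^sup>+ y. \<Phi> y \<partial>?M) = (\<integral>\<^sup>+ y. ennreal (?w y) \<partial>?M)"
    by (intro nn_integral_cong_AE) (auto simp: \<Phi>_def elim: eventually_mono)
  then have eq: "F_mass W \<mu> \<tau> = (\<integral>\<^sup>+ y. ennreal (?w y) \<partial>?M)" using F by simp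
  have nn: "0 \<le> ?w y" for y using W(2)[of y] dual_norm_nonneg[of "\<tau> y"] by simp
  show int: "integrable ?M ?w"
  proof (rule integrableI_bounded)
    have "(\<integral>\<^sup>+ y. ennreal (norm (?w y)) \<partial>?M) = F_mass W \<mu> \<tau>"
      unfolding eq using nn by (intro nn_integral_cong) (simp add: abs_of_nonneg)
    then show "(\<integral>\<^sup>+ y. ennreal (norm (?w y)) \<partial>?M) < \<infinity>" using fin by (simp add: less_top)
  qed measurable
  show "F_mass W \<mu> \<tau> = ennreal (\<integral>y. ?w y \<partial>?M)"
    unfolding eq using nn by (intro nn_integral_eq_integral int) auto
qed

theorem theorem31:
  fixes am ap :: "real^2"
    and W lam h :: "real^2 \<Rightarrow> real"
    and c1 c2 pbar :: real
    and T :: "(real^2 \<Rightarrow> real^2^2) \<Rightarrow> real"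
    and \<mu> :: "(real^2) measure"
    and \<tau> :: "real^2 \<Rightarrow> real^2^2"
  assumes "am $ 1 = ap $ 1" and "am $ 2 < ap $ 2"
    and "continuous_on UNIV W" and "\<And>y. 0 \<le> W y"
    and "c1 > 0" and "c2 > 0" and "pbar > 0"
    and "\<And>y. c1 * norm y powr (2 * pbar) - 1 \<le> W y"
    and "\<And>y. W y \<le> c2 * (norm y powr (2 * pbar) + 1)"
    and "lam \<in> borel_measurable borel" and "\<And>y. lam y \<in> {-1..1}"
    and "h \<in> Cjq 2 (2 + pbar)"
    and "\<And>y. partial 1 (partial 1 h) y = - lam y * sqrt (W y)"
    and "T \<in> C0_currents am ap"
    and "polar_decomposition T \<mu> \<tau>"
  shows "enn2ereal (F_mass W \<mu> \<tau>) \<ge> ereal (1/2) * (INF \<gamma>\<in>Gamma1 am ap. ereal (Z_fun W lam h \<gamma>))"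
proof -
  note W_cont = assms(3) and W_nonneg = assms(4) and c_pos = assms(5-7)
    and W_lower = assms(8) and W_upper = assms(9) and lam_meas [measurable] = assms(10) and lam = assms(11)
    and h_eq = assms(13) and T = assms(14) and pd = assms(15)
  define sW where "sW x = sqrt (W x)" for x
  define h1 where "h1 = partial 1 h"
  define h2 where "h2 = partial 2 h"
  define h22 where "h22 = partial 2 h2"
  \<comment> \<open>the integrand of \<open>Z\<close>; the boundary terms of \<open>Z\<close> depend on the endpoints only and are treated
    separately\<close>
  define Lag where "Lag x z = sW x * Theta (lam x) z + h22 x * z $ 2" for x z
  have sW_nonneg: "0 \<le> sW x" for x using W_nonneg by (simp add: sW_def)
  have sW_cont: "continuous_on UNIV sW" unfolding sW_def by (intro continuous_intros W_cont)
  have hC: "Cj 2 h" using assms(12) by (simp add: Cjq_def)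
  obtain C where C: "0 \<le> C" "\<And>y k. k \<le> 2 \<Longrightarrow> norm_D k h y \<le> C * (norm y powr (2 + pbar - real k) + 1)"
    using assms(12) unfolding Cjq_def by blast
  have h1C: "Cj 1 h1" and h2C: "Cj 1 h2" using hC by (simp_all add: h1_def h2_def numeral_2_eq_2)
  have h22_cont: "continuous_on UNIV h22" using h2C by (simp add: h22_def)
  have h1_bound: "\<bar>h1 y\<bar> \<le> C * (norm y powr (1 + pbar) + 1)"
    and h2_bound: "\<bar>h2 y\<bar> \<le> C * (norm y powr (1 + pbar) + 1)"
    and h22_bound: "\<bar>h22 y\<bar> \<le> C * (norm y powr pbar + 1)" for y
    using norm_partials_le_norm_D[of "[1]" h y] norm_partials_le_norm_D[of "[2]" h y]
      norm_partials_le_norm_D[of "[2, 2]" h y] C(2)[of 1 y] C(2)[of 2 y]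
    by (simp_all add: h1_def h2_def h22_def numeral_2_eq_2)
  have sW_bound: "sW y \<le> sqrt c2 * (norm y powr pbar + 1)" for y
  proof -
    have "norm y powr (2 * pbar) = (norm y powr pbar)\<^sup>2"
      by (simp add: power2_eq_square powr_add[symmetric])
    then have "W y \<le> c2 * (norm y powr pbar + 1)\<^sup>2"
      using W_upper[of y] c_pos
      by (elim order_trans, intro mult_left_mono) (auto simp: power2_eq_square algebra_simps)
    then have "sW y \<le> sqrt (c2 * (norm y powr pbar + 1)\<^sup>2)" by (simp add: sW_def)
    also have "\<dots> = sqrt c2 * (norm y powr pbar + 1)" by (simp add: real_sqrt_mult add_nonneg_nonneg)
    finally show ?thesis .
  qed
  define D where "D = 2 * sqrt c2 + C"
  have D: "0 \<le> D" using C c_pos by (simp add: D_def)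
  have Lag_bound: "\<bar>Lag u z\<bar> \<le> D * (\<rho> powr pbar + 1) * norm z" if u: "norm u \<le> \<rho>" for u z \<rho>
  proof -
    have mono: "norm u powr pbar \<le> \<rho> powr pbar" using u c_pos by (intro powr_mono2) auto
    have "\<bar>Lag u z\<bar> \<le> sW u * \<bar>Theta (lam u) z\<bar> + \<bar>h22 u\<bar> * \<bar>z $ 2\<bar>"
      unfolding Lag_def using sW_nonneg[of u] by (metis abs_mult abs_of_nonneg abs_triangle_ineq)
    also have "\<dots> \<le> (sqrt c2 * (\<rho> powr pbar + 1)) * (2 * norm z) + (C * (\<rho> powr pbar + 1)) * norm z"
    proof (intro add_mono mult_mono)
      show "sW u \<le> sqrt c2 * (\<rho> powr pbar + 1)"
        by (rule order_trans[OF sW_bound]) (use mono c_pos in \<open>simp add: mult_left_mono\<close>)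
      show "\<bar>h22 u\<bar> \<le> C * (\<rho> powr pbar + 1)"
        by (rule order_trans[OF h22_bound]) (use mono C in \<open>simp add: mult_left_mono\<close>)
      show "\<bar>z $ 2\<bar> \<le> norm z" by (rule component_le_norm_cart)
    qed (use abs_Theta_le[OF lam] C c_pos in \<open>auto intro!: mult_nonneg_nonneg add_nonneg_nonneg\<close>)
    finally show ?thesis by (simp add: D_def algebra_simps)
  qed
  interpret lagrangian Lag
  proof
    fix z x and t :: real
    have [measurable]: "sW \<in> borel_measurable borel" "h22 \<in> borel_measurable borel"
      using sW_cont h22_cont by (auto intro: borel_measurable_continuous_onI)
    show "(\<lambda>x. Lag x z) \<in> borel_measurable borel" unfolding Lag_def by measurable
    show "locally_bounded (\<lambda>x. Lag x z)" unfolding locally_bounded_def using Lag_bound by blast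
    show "Lag x (t *\<^sub>R z) = t * Lag x z" if "0 \<le> t"
      using Theta_scale[OF that] by (simp add: Lag_def algebra_simps)
  qed
  let ?J = "INF \<gamma>\<in>Gamma1 am ap. ereal (Z_fun W lam h \<gamma>)"
  have J_le: "?J \<le> ereal (c - h2 ap + h2 am)" if reach: "reaches Lag am ap c" for c
  proof -
    obtain \<gamma> where \<gamma>: "\<gamma> \<in> Gamma1 am ap"
      "(\<integral>t. Lag (\<gamma> t) (vector_derivative \<gamma> (at t within {0..1})) \<partial>lebesgue_on {0..1}) = c"
      using reaches_imp_integral[OF reach] by blast
    have "\<gamma> 0 = am" "\<gamma> 1 = ap" using \<gamma>(1) by (auto simp: Gamma1_def)
    then have "Z_fun W lam h \<gamma> = c - h2 ap + h2 am"
      using \<gamma>(2) by (simp add: Z_fun_def Let_def Lag_def sW_def h22_def h2_def)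
    then show ?thesis using INF_lower[OF \<gamma>(1), of "\<lambda>\<gamma>. ereal (Z_fun W lam h \<gamma>)"] by simp
  qed
  have "reaches Lag am ap (cost am (ap - am))"
    using reaches_step[OF reaches_start, of am "ap - am"] by simp
  from J_le[OF this] have "?J \<noteq> \<infinity>" by auto
  then consider "F_mass W \<mu> \<tau> = \<infinity>" | "?J = - \<infinity>" | j where "F_mass W \<mu> \<tau> \<noteq> \<infinity>" "?J = ereal j"
    by (cases ?J) auto
  then show ?thesis
  proof cases
    case 1
    then show ?thesis by simp
  next
    case 2
    then show ?thesis by simp
  next
    case 3
    define w where "w y = 1/2 * sW y" for y
    define m where "m = j + h2 ap - h2 am"
    have lower: "\<forall>c. reaches Lag am ap c \<longrightarrow> m \<le> c"
      using J_le 3(2) by (fastforce simp: m_def)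
    \<comment> \<open>the calibration \<open>1/2 (d - \<partial>\<^sub>2h, - \<partial>\<^sub>1h)\<close>\<close>
    define f where "f i = (if i = 1 then (\<lambda>y. 1/2 * (least_cost am y - h2 y)) else (\<lambda>y. - (1/2) * h1 y))" for i :: 2
    note fin = F_mass_finite_imp[OF pd W_cont W_nonneg 3(1)]
    have "continuous_on UNIV (least_cost am)"
      using least_cost_continuous[OF lower] Lag_bound by blast
    then have f_cont: "continuous_on UNIV (f i)" for i
      using Cj_continuous[OF h1C] Cj_continuous[OF h2C] unfolding f_def by (auto intro!: continuous_intros)
    have w: "continuous_on UNIV w" "\<And>y. 0 \<le> w y"
      unfolding w_def using sW_nonneg by (auto intro!: continuous_intros sW_cont)
    have calib: "\<exists>g. (\<forall>i. g i \<in> borel_measurable borel \<and> locally_bounded (g i) \<and>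
       (\<forall>x t. 0 < t \<longrightarrow> f i (x + t *\<^sub>R N $ i) - f i x \<le> t * segment_mean (g i) x (t *\<^sub>R N $ i))) \<and>
       (\<forall>x. (\<Sum>i\<in>UNIV. g i x) \<le> w x * dual_norm N)" if N: "trace N = 0" for N
    proof -
      let ?L = "\<lambda>x. Lag x (N $ 1)"
      define g1 where "g1 x = (\<Sum>i\<in>UNIV. N $ 2 $ i * partial i h1 x)" for x
      define g2 where "g2 x = (\<Sum>i\<in>UNIV. N $ 1 $ i * partial i h2 x)" for x
      have c: "continuous_on UNIV g1" "continuous_on UNIV g2"
        unfolding g1_def g2_def using h1C h2C by (auto intro!: continuous_intros)
      have g: "g1 \<in> borel_measurable borel" "locally_bounded g1" "g2 \<in> borel_measurable borel" "locally_bounded g2"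
        using c by (auto intro: borel_measurable_continuous_onI continuous_locally_bounded)
      \<comment> \<open>bounds for the directional derivatives of \<open>f 1\<close> along the first row of \<open>N\<close> and of \<open>f 2\<close>
        along the second; the term with factor \<open>0\<close> brings the second bound into the form of
        \<open>segment_mean_linear\<close>\<close>
      define g where "g i = (if i = 1 then (\<lambda>x. 1/2 * ?L x + (- 1/2) * g2 x) else (\<lambda>x. (- 1/2) * g1 x + 0 * g1 x))" for i :: 2
      have lb_scale: "locally_bounded (\<lambda>x. a * k x)" if "locally_bounded k" for a k
        using locally_bounded_mult[OF continuous_locally_bounded[OF continuous_on_const] that, of a] by simp
      have "locally_bounded (\<lambda>x. 1/2 * ?L x + (- 1/2) * g2 x)" "locally_bounded (\<lambda>x. (- 1/2) * g1 x + 0 * g1 x)"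
        by (rule locally_bounded_add lb_scale Lag_lb g)+
      then have meas: "g i \<in> borel_measurable borel" "locally_bounded (g i)" for i
        using g unfolding g_def by simp_all
      have step1: "least_cost am (x + t *\<^sub>R N $ 1) - least_cost am x \<le> t * segment_mean ?L x (t *\<^sub>R N $ 1)"
        if t: "0 < t" for x t
      proof -
        have "cost x (t *\<^sub>R N $ 1) = segment_mean (\<lambda>u. t * ?L u + 0 * ?L u) x (t *\<^sub>R N $ 1)"
          using t by (simp add: cost_def Lag_scale)
        also have "\<dots> = t * segment_mean ?L x (t *\<^sub>R N $ 1)"
          using segment_mean_linear[OF Lag_meas Lag_lb Lag_meas Lag_lb, of t "N $ 1" 0 "N $ 1"] by simp
        finally show ?thesis using least_cost_step[OF lower, of x "t *\<^sub>R N $ 1"] by simp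
      qed
      have "f i (x + t *\<^sub>R N $ i) - f i x \<le> t * segment_mean (g i) x (t *\<^sub>R N $ i)" if t: "0 < t" for i x t
      proof (cases "i = 1")
        case True
        have h2_step: "h2 (x + t *\<^sub>R N $ 1) - h2 x = t * segment_mean g2 x (t *\<^sub>R N $ 1)"
          using segment_mean_derivative[OF h2C, of "N $ 1" x t] unfolding g2_def by (simp add: mult.commute)
        have mean: "segment_mean (g 1) x (t *\<^sub>R N $ 1)
            = 1/2 * segment_mean ?L x (t *\<^sub>R N $ 1) + (- 1/2) * segment_mean g2 x (t *\<^sub>R N $ 1)"
          unfolding g_def using segment_mean_linear[OF Lag_meas Lag_lb g(3,4), of "1/2" "N $ 1" "- 1/2"] by simp
        define A B where "A = t * segment_mean ?L x (t *\<^sub>R N $ 1)" and "B = t * segment_mean g2 x (t *\<^sub>R N $ 1)"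
        have "t * segment_mean (g 1) x (t *\<^sub>R N $ 1) = 1/2 * (A - B)"
          unfolding mean A_def B_def by (simp add: algebra_simps)
        then show ?thesis
          using True step1[OF t, of x, folded A_def] h2_step[folded B_def]
          by (simp add: f_def right_diff_distrib)
      next
        case False
        then have i: "i = 2" using exhaust_2[of i] by simp
        have "h1 (x + t *\<^sub>R N $ 2) - h1 x = t * segment_mean g1 x (t *\<^sub>R N $ 2)"
          using segment_mean_derivative[OF h1C, of "N $ 2" x t] unfolding g1_def by (simp add: mult.commute)
        moreover have "segment_mean (g 2) x (t *\<^sub>R N $ 2) = (- 1/2) * segment_mean g1 x (t *\<^sub>R N $ 2)"
          unfolding g_def using segment_mean_linear[OF g(1,2,1,2), of "- 1/2" 0] by simp
        ultimately show ?thesis using i by (simp add: f_def algebra_simps)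
      qed
      moreover have "(\<Sum>i\<in>UNIV. g i x) \<le> w x * dual_norm N" for x
      proof -
        have N22: "N $ 2 $ 2 = - N $ 1 $ 1" using N by (simp add: trace_def sum_2)
        have sym: "partial 1 h2 x = partial 2 h1 x"
          unfolding h1_def h2_def by (rule partial_commute[OF hC])
        have h11: "partial 1 h1 x = - lam x * sW x" using h_eq by (simp add: h1_def sW_def)
        \<comment> \<open>the terms with \<open>\<partial>\<^sub>2\<^sub>2h\<close> cancel, and those with mixed derivatives cancel because \<open>N\<close> is
          trace free\<close>
        have "(\<Sum>i\<in>UNIV. g i x) = w x * (Theta (lam x) (N $ 1) + lam x * N $ 2 $ 1)"
          by (simp add: sum_2 g_def g1_def g2_def Lag_def sym h11 N22 h22_def w_def algebra_simps)
        also have "\<dots> \<le> w x * dual_norm N"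
          using Theta_le_max[OF lam, of x "N $ 1" "N $ 2 $ 1"] w(2)[of x]
          unfolding dual_norm_def by (intro mult_left_mono)
        finally show ?thesis .
      qed
      ultimately show ?thesis using meas by (intro exI[of _ g]) blast
    qed
    \<comment> \<open>beyond this radius \<open>\<bar>y\<bar>\<close> exceeds \<open>1\<close> and the norms of both endpoints, and \<open>c1 \<bar>y\<bar>\<close> to the
      power \<open>2 pbar\<close> is at least \<open>2\<close>, which absorbs the \<open>- 1\<close> in the lower bound on \<open>W\<close>\<close>
    define r where "r = 1 + norm am + norm ap + (2 / c1) powr (1 / (2 * pbar))"
    define K1 where "K1 = \<bar>m\<bar> + 2 * D * (3 powr pbar + 1) + 2 * C"
    define K where "K = K1 + 2 * sqrt (2 / c1)"
    have K1: "0 \<le> K1" using D C by (simp add: K1_def)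
    have K: "K1 \<le> K" "2 * sqrt (2 / c1) \<le> K" "0 \<le> K" using K1 c_pos by (auto simp: K_def)
    have growth_f: "\<bar>f i y\<bar> \<le> K * norm y powr (1 + pbar)" if y: "r \<le> norm y" for i y
    proof -
      have y1: "1 \<le> norm y" "norm am \<le> norm y" "norm ap \<le> norm y"
        using y powr_ge_zero[of "2 / c1" "1 / (2 * pbar)"] norm_ge_zero[of am] norm_ge_zero[of ap]
        unfolding r_def by linarith+
      define Y where "Y = norm y powr (1 + pbar)"
      have Y: "1 \<le> Y" unfolding Y_def using y1 c_pos by (intro ge_one_powr_ge_zero) auto
      have Yp: "1 \<le> norm y powr pbar" using y1 c_pos by (intro ge_one_powr_ge_zero) auto
      have YY: "norm y * norm y powr pbar = Y" unfolding Y_def using y1 by (simp add: powr_add)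
      have cost: "\<bar>cost x z\<bar> \<le> 2 * D * (3 powr pbar + 1) * Y"
        if xz: "norm x + norm z \<le> 3 * norm y" "norm z \<le> 2 * norm y" for x z
      proof -
        have "\<bar>cost x z\<bar> \<le> D * ((3 * norm y) powr pbar + 1) * norm z"
          by (rule cost_bound[OF Lag_bound xz(1)])
        also have "\<dots> \<le> D * (3 powr pbar * norm y powr pbar + norm y powr pbar) * (2 * norm y)"
          using D Yp xz by (intro mult_mono) (auto simp: powr_mult)
        also have "\<dots> = 2 * D * (3 powr pbar + 1) * Y" unfolding YY[symmetric] by (simp add: algebra_simps)
        finally show ?thesis .
      qed
      have z: "norm (ap - y) \<le> norm ap + norm y" "norm (y - am) \<le> norm y + norm am"
        using norm_triangle_ineq4 by blast+
      have "\<bar>cost y (ap - y)\<bar> \<le> 2 * D * (3 powr pbar + 1) * Y" "\<bar>cost am (y - am)\<bar> \<le> 2 * D * (3 powr pbar + 1) * Y"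
        using z y1 by (intro cost; linarith)+
      moreover have "m - cost y (ap - y) \<le> least_cost am y" "least_cost am y \<le> cost am (y - am)"
        using least_cost_bounds[OF lower] by blast+
      moreover have "\<bar>m\<bar> \<le> \<bar>m\<bar> * Y" using Y mult_left_mono[OF Y, of "\<bar>m\<bar>"] by simp
      ultimately have d: "\<bar>least_cost am y\<bar> \<le> \<bar>m\<bar> * Y + 2 * D * (3 powr pbar + 1) * Y" by linarith
      have "C * (Y + 1) \<le> C * (Y + Y)" using C Y by (intro mult_left_mono) auto
      then have h: "\<bar>h1 y\<bar> \<le> 2 * C * Y" "\<bar>h2 y\<bar> \<le> 2 * C * Y"
        using h1_bound[of y] h2_bound[of y] unfolding Y_def by simp_all
      have "0 \<le> \<bar>m\<bar> * Y" "0 \<le> 2 * D * (3 powr pbar + 1) * Y" "0 \<le> 2 * C * Y" using D C Y by auto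
      then have "\<bar>f i y\<bar> \<le> \<bar>m\<bar> * Y + 2 * D * (3 powr pbar + 1) * Y + 2 * C * Y"
        using d h unfolding f_def by (auto simp: abs_mult)
      also have "\<dots> = K1 * Y" by (simp add: K1_def algebra_simps)
      also have "\<dots> \<le> K * Y" using K Y by (intro mult_right_mono) auto
      finally show ?thesis by (simp add: Y_def)
    qed
    have growth_w: "norm y powr pbar \<le> K * w y" if y: "r \<le> norm y" for y
    proof -
      have "(2 / c1) powr (1 / (2 * pbar)) \<le> norm y"
        using y norm_ge_zero[of am] norm_ge_zero[of ap] unfolding r_def by linarith
      then have "((2 / c1) powr (1 / (2 * pbar))) powr (2 * pbar) \<le> norm y powr (2 * pbar)"
        using c_pos by (intro powr_mono2) auto
      then have "2 / c1 \<le> norm y powr (2 * pbar)" using c_pos by (simp add: powr_powr)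
      then have "2 \<le> c1 * norm y powr (2 * pbar)" using c_pos by (simp add: field_simps)
      then have "c1 * norm y powr (2 * pbar) \<le> 2 * W y" using W_lower[of y] by simp
      then have "norm y powr (2 * pbar) \<le> 2 / c1 * W y" using c_pos by (simp add: field_simps)
      moreover have "norm y powr (2 * pbar) = (norm y powr pbar)\<^sup>2"
        by (simp add: power2_eq_square powr_add[symmetric])
      ultimately have "norm y powr pbar \<le> sqrt (2 / c1 * W y)" by (intro real_le_rsqrt) simp
      also have "\<dots> = 2 * sqrt (2 / c1) * w y" by (simp add: w_def sW_def real_sqrt_mult[symmetric])
      also have "\<dots> \<le> K * w y" using K w(2)[of y] by (intro mult_right_mono) auto
      finally show ?thesis .
    qed
    have "f 1 ap - f 1 am \<le> (\<integral>y. w y * dual_norm (\<tau> y) \<partial>completion \<mu>)"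
      by (rule calibration_bound[OF T pd fin(1) w _ f_cont calib growth_f growth_w c_pos(3) K(3)])
         (use fin(2) in \<open>auto simp: w_def sW_def\<close>)
    moreover have "1/2 * j \<le> f 1 ap - f 1 am"
      using least_cost_bounds(3,4)[OF lower] by (simp add: f_def m_def field_simps)
    moreover have "F_mass W \<mu> \<tau> = ennreal (\<integral>y. w y * dual_norm (\<tau> y) \<partial>completion \<mu>)"
      using fin(3) by (simp add: w_def sW_def)
    moreover have "0 \<le> (\<integral>y. w y * dual_norm (\<tau> y) \<partial>completion \<mu>)"
      using w(2) dual_norm_nonneg by (intro Bochner_Integration.integral_nonneg) auto
    ultimately show ?thesis using 3(2) by (simp add: enn2ereal_ennreal)
  qed
qed

end
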